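(* Let $M=\{\mu_k\}_{k\ge1}\subset\mathbb{C}$ be a countable set of nodes that is discrete in $\mathbb{C}$, with multiplicities $m_k\in\mathbb{N}$, and let $\Lambda\subset\mathbb{C}$ be an unbounded set. Assume that for every $s_\tau\in P(M)$ at least one of conditions (A), (B) below holds. Let $\{\lambda_n\}\subset\Lambda$ be an arbitrary sequence with $|\lambda_{n+1}|>2|\lambda_n|$ for all $n$ and $P(\{\lambda_n\})=P_M(\Lambda)$, and let $G_1(z)=\prod_{n=1}^\infty\left(1-\frac{z}{\lambda_n}\right)$. Then: 1) the subspace $\operatorname{Ker}M_{G_1}+(\psi_M)$ is closed in $H(\mathbb{C})$; if $d_M>0$ it has codimension exactly $d_M$ in $H(\mathbb{C})$, and there exist $\xi_1,\dots,\xi_{d_M}\in\mathbb{C}$ such that $$H(\mathbb{C})=\operatorname{Ker}M_{G_1}+(\psi_M)+\operatorname{span}\{e^{\xi_l z}\}_{l=1}^{d_M};$$ 2) if $d_M=0$, then $H(\mathbb{C})=\operatorname{Ker}M_{G_1}+(\psi_M)$; 3) the subspace $\operatorname{Ker}M_{G_1}\cap(\psi_M)$ is infinite-dimensional.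
   Context: $H(\mathbb{C})$ is the space of entire functions with the topology of uniform convergence on compact sets. $\mathbb{S}=\{s\in\mathbb{C}:|s|=1\}$. For an unbounded set $X\subset\mathbb{C}$, the set $P(X)\subset\mathbb{S}$ of limit directions at infinity consists of all $s\in\mathbb{S}$ such that $s=\lim_{k\to\infty}x_k/|x_k|$ for some sequence $\{x_k\}\subset X$ with $x_k\to\infty$. Elements of $P(M)$ are written $s_\tau=e^{i\tau}$ and elements of $P(\Lambda)$ are written $s_\omega=e^{i\omega}$. For $s\in\mathbb{S}$ and $c\in\mathbb{R}$ let $l(s,c)=\{z\in\mathbb{C}:\operatorname{Re}(sz)=c\}$. Condition (A) for $s_\tau\in P(M)$: there exists $s_\omega\in P(\Lambda)$ with $\operatorname{Re}(s_\omega s_\tau)>0$ and a number $\varkappa=\varkappa(s_\omega)\in\mathbb{R}$ such that for every $c>\varkappa$ the line $l(s_\omega,c)$ contains at most one node $\mu_k\in M$. Condition (B) for $s_\tau\in P(M)$: there exists $s_\omega\in P(\Lambda)$ with $\operatorname{Re}(s_\omega s_\tau)=0$ and a number $\varkappa=\varkappa(s_\omega)\in\mathbb{R}$ such that for every $c>\varkappa$ the line $l(s_\omega,c)$ contains at most one node $\mu_k\in M$, and moreover for every subsequence $\{\mu_{k_l}\}\subset M$ with $|\mu_{k_l}|\to\infty$ and $\mu_{k_l}/|\mu_{k_l}|\to s_\tau$ one has $\operatorname{Re}(s_\omega\mu_{k_l})\to+\infty$. $P_M(\Lambda)\subset P(\Lambda)$ denotes the set of all directions $s_\omega\in P(\Lambda)$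 that occur, coupled with some $s_\tau\in P(M)$, in (A) or (B) (with the corresponding numbers $\varkappa(s_\omega)$). Set $D_M=\bigcap_{s_\omega\in P_M(\Lambda)}\{\mu_k\in M:\operatorname{Re}(s_\omega\mu_k)\le\varkappa(s_\omega)\}$; under the hypotheses this set is finite or empty. $d_M\in\mathbb{Z}_+$ is the dimension of the space of all quasi-polynomials $P(z)=\sum_{\mu_k\in D_M}\sum_{j=0}^{m_k-1}c_{k,j}z^je^{\mu_k z}$ ($c_{k,j}\in\mathbb{C}$) that satisfy $P(\lambda_n)=0$ for all $n$ (so $d_M=0$ if $D_M=\emptyset$). $\psi_M\in H(\mathbb{C})$ is an entire function whose zero set is exactly $M$, with the zero at $\mu_k$ of multiplicity exactly $m_k$; $(\psi_M)=\{r\psi_M: r\in H(\mathbb{C})\}$ is the ideal it generates. $M_{G_1}$ is the convolution operator on $H(\mathbb{C})$ generated by the entire function $G_1$ (of minimal type with respect to order 1): if $G_1(z)=\sum_{j\ge0}a_jz^j$ then $M_{G_1}f=\sum_{j\ge0}a_jf^{(j)}$, so that $M_{G_1}e^{\lambda z}=G_1(\lambda)e^{\lambda z}$. Its kernel coincides with the set of sums $\sum_{n}c_ne^{\lambda_nz}$ of series absolutely convergent for all $z\in\mathbb{C}$. *)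

theory Defs
  imports "HOL-Complex_Analysis.Complex_Analysis"
begin

definition entire :: "(complex \<Rightarrow> complex) \<Rightarrow> bool" where
  "entire f \<longleftrightarrow> f holomorphic_on UNIV"

definition Hspace :: "(complex \<Rightarrow> complex) set" where
  "Hspace = {f. entire f}"

text \<open>Sequential closedness w.r.t. uniform convergence on compact sets
  (H(C) is a Frechet space, hence metrizable, so this is closedness).\<close>
definition closed_H :: "(complex \<Rightarrow> complex) set \<Rightarrow> bool" where
  "closed_H S \<longleftrightarrow> (\<forall>f g. (\<forall>n. f n \<in> S) \<longrightarrow>
      (\<forall>K. compact K \<longrightarrow> uniform_limit K f g sequentially) \<longrightarrow> g \<in> S)"

definition sum_space :: "(complex \<Rightarrow> complex) set \<Rightarrow> (complex \<Rightarrow> complex) set \<Rightarrow> (complex \<Rightarrow> complex) set" where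
  "sum_space A B = {(\<lambda>z. f z + g z) | f g. f \<in> A \<and> g \<in> B}"

definition lin_comb :: "(nat \<Rightarrow> complex \<Rightarrow> complex) \<Rightarrow> nat \<Rightarrow> (nat \<Rightarrow> complex) \<Rightarrow> complex \<Rightarrow> complex" where
  "lin_comb g d c = (\<lambda>z. \<Sum>i<d. c i * g i z)"

definition span_fun :: "(nat \<Rightarrow> complex \<Rightarrow> complex) \<Rightarrow> nat \<Rightarrow> (complex \<Rightarrow> complex) set" where
  "span_fun g d = {lin_comb g d c | c. True}"

definition lin_indep_fun :: "(nat \<Rightarrow> complex \<Rightarrow> complex) \<Rightarrow> nat \<Rightarrow> bool" where
  "lin_indep_fun g d \<longleftrightarrow> (\<forall>c. lin_comb g d c = (\<lambda>z. 0) \<longrightarrow> (\<forall>i<d. c i = 0))"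

definition has_dim :: "(complex \<Rightarrow> complex) set \<Rightarrow> nat \<Rightarrow> bool" where
  "has_dim V d \<longleftrightarrow> (\<exists>g. (\<forall>i<d. g i \<in> V) \<and> lin_indep_fun g d \<and> V = span_fun g d)"

definition codim_H :: "(complex \<Rightarrow> complex) set \<Rightarrow> nat \<Rightarrow> bool" where
  "codim_H S d \<longleftrightarrow> (\<exists>g. (\<forall>i<d. g i \<in> Hspace) \<and> Hspace = sum_space S (span_fun g d) \<and>
       (\<forall>c. lin_comb g d c \<in> S \<longrightarrow> (\<forall>i<d. c i = 0)))"

definition infinite_dim :: "(complex \<Rightarrow> complex) set \<Rightarrow> bool" where
  "infinite_dim S \<longleftrightarrow> (\<forall>n. \<exists>g. (\<forall>i<n. g i \<in> S) \<and> lin_indep_fun g n)"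

definition exps :: "(nat \<Rightarrow> complex) \<Rightarrow> nat \<Rightarrow> complex \<Rightarrow> complex" where
  "exps \<xi> = (\<lambda>l z. exp (\<xi> l * z))"

definition limdirs :: "complex set \<Rightarrow> complex set" where
  "limdirs X = {s. norm s = 1 \<and> (\<exists>x. (\<forall>k. x k \<in> X) \<and> filterlim x at_infinity sequentially \<and>
       (\<lambda>k. x k / complex_of_real (norm (x k))) \<longlonglongrightarrow> s)}"

definition line :: "complex \<Rightarrow> real \<Rightarrow> complex set" where
  "line s c = {z. Re (s * z) = c}"

definition at_most_one_node :: "complex set \<Rightarrow> complex \<Rightarrow> real \<Rightarrow> bool" where
  "at_most_one_node M s c \<longleftrightarrow> (\<forall>\<mu>1\<in>M \<inter> line s c. \<forall>\<mu>2\<in>M \<inter> line s c. \<mu>1 = \<mu>2)"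

definition line_cond :: "complex set \<Rightarrow> complex \<Rightarrow> real \<Rightarrow> bool" where
  "line_cond M s \<kappa> \<longleftrightarrow> (\<forall>c>\<kappa>. at_most_one_node M s c)"

definition condA :: "complex set \<Rightarrow> complex set \<Rightarrow> complex \<Rightarrow> complex \<Rightarrow> real \<Rightarrow> bool" where
  "condA M Lam \<tau> \<omega> \<kappa> \<longleftrightarrow> \<omega> \<in> limdirs Lam \<and> Re (\<omega> * \<tau>) > 0 \<and> line_cond M \<omega> \<kappa>"

definition condB :: "complex set \<Rightarrow> complex set \<Rightarrow> complex \<Rightarrow> complex \<Rightarrow> real \<Rightarrow> bool" where
  "condB M Lam \<tau> \<omega> \<kappa> \<longleftrightarrow> \<omega> \<in> limdirs Lam \<and> Re (\<omega> * \<tau>) = 0 \<and> line_cond M \<omega> \<kappa> \<and>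
     (\<forall>x. (\<forall>l. x l \<in> M) \<longrightarrow> filterlim x at_infinity sequentially \<longrightarrow>
          (\<lambda>l. x l / complex_of_real (norm (x l))) \<longlonglongrightarrow> \<tau> \<longrightarrow>
          filterlim (\<lambda>l. Re (\<omega> * x l)) at_top sequentially)"

definition PM :: "complex set \<Rightarrow> complex set \<Rightarrow> complex set" where
  "PM M Lam = {\<omega>. \<exists>\<tau>\<in>limdirs M. \<exists>\<kappa>. condA M Lam \<tau> \<omega> \<kappa> \<or> condB M Lam \<tau> \<omega> \<kappa>}"

definition DM :: "complex set \<Rightarrow> complex set \<Rightarrow> (complex \<Rightarrow> real) \<Rightarrow> complex set" where
  "DM M Lam \<kappa> = {\<mu> \<in> M. \<forall>\<omega>\<in>PM M Lam. Re (\<omega> * \<mu>) \<le> \<kappa> \<omega>}"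

definition quasi_poly :: "complex set \<Rightarrow> (complex \<Rightarrow> nat) \<Rightarrow> (complex \<Rightarrow> nat \<Rightarrow> complex) \<Rightarrow> complex \<Rightarrow> complex" where
  "quasi_poly D m c = (\<lambda>z. \<Sum>\<mu>\<in>D. \<Sum>j<m \<mu>. c \<mu> j * z ^ j * exp (\<mu> * z))"

definition vanishing_qp :: "complex set \<Rightarrow> complex set \<Rightarrow> (complex \<Rightarrow> real) \<Rightarrow> (complex \<Rightarrow> nat) \<Rightarrow> (nat \<Rightarrow> complex) \<Rightarrow> (complex \<Rightarrow> complex) set" where
  "vanishing_qp M Lam \<kappa> m lam =
     {quasi_poly (DM M Lam \<kappa>) m c | c. \<forall>n. quasi_poly (DM M Lam \<kappa>) m c (lam n) = 0}"

definition dM :: "complex set \<Rightarrow> complex set \<Rightarrow> (complex \<Rightarrow> real) \<Rightarrow> (complex \<Rightarrow> nat) \<Rightarrow> (nat \<Rightarrow> complex) \<Rightarrow> nat" where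
  "dM M Lam \<kappa> m lam = (THE d. has_dim (vanishing_qp M Lam \<kappa> m lam) d)"

definition G1 :: "(nat \<Rightarrow> complex) \<Rightarrow> complex \<Rightarrow> complex" where
  "G1 lam = (\<lambda>z. \<Prod>n. (1 - z / lam n))"

definition taylor_coeff :: "(complex \<Rightarrow> complex) \<Rightarrow> nat \<Rightarrow> complex" where
  "taylor_coeff G j = (deriv ^^ j) G 0 / of_nat (fact j)"

definition conv_ker :: "(complex \<Rightarrow> complex) \<Rightarrow> (complex \<Rightarrow> complex) set" where
  "conv_ker G = {f \<in> Hspace. \<forall>z. (\<lambda>j. taylor_coeff G j * (deriv ^^ j) f z) sums 0}"

definition ideal_gen :: "(complex \<Rightarrow> complex) \<Rightarrow> (complex \<Rightarrow> complex) set" where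
  "ideal_gen \<psi> = {(\<lambda>z. r z * \<psi> z) | r. entire r}"

end

theory Submission imports Defs begin

text \<open>The jets of an entire function at the nodes determine it modulo \<open>(\<psi>)\<close>, so the question is which
  jets are realised by \<open>Ker M\<^sub>G\<close>. A finite combination of jet functionals acts on \<open>e\<^bsup>\<lambda>z\<^esup>\<close> as a quasi-polynomial
  in \<open>\<lambda>\<close>; along \<open>\<lambda>\<^sub>n\<close> tending to a direction \<open>\<omega>\<close> its frequency of largest \<open>Re (\<omega>\<mu>)\<close> is unique beyond
  \<open>\<kappa> \<omega>\<close> and dominates, so only combinations supported on a finite set of nodes are bounded with
  respect to \<open>\<Sum>\<bar>c\<^sub>n\<bar> e\<^bsup>r\<bar>\<lambda>\<^sub>n\<bar>\<^esup>\<close>. This is Eidelheit's criterion, and a Mittag-Leffler procedure then solves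
  the interpolation problem for every jet annihilated by the vanishing quasi-polynomials on \<open>D\<^sub>M\<close>. Conversely
  these annihilate \<open>Ker M\<^sub>G\<close>, because it is the closure of the span of the \<open>e\<^bsup>\<lambda>\<^sub>n z\<^esup>\<close>. Infinite dimension of
  the intersection follows since dropping finitely many \<open>\<lambda>\<^sub>n\<close> leaves the defect at most the number of jets
  on \<open>D\<^sub>M\<close>.\<close>

section \<open>Finite-dimensional linear algebra\<close>

text \<open>The interpolation handles finite exponential sums, coded by their coefficient sequences,
  and takes one limit at the end. The obstacle is to prescribe jets at new nodes by a correction
  that is small on the disc of radius r and leaves the earlier jets alone. Duality for finitely many
  functionals says when this is possible: every combination of jets that is bounded by the r-th
  weighted norm must annihilate the residual. Such a combination has its frequencies among the nodes
  with Re (\<omega>\<mu>) \<le> max r (\<kappa> \<omega>) for all \<omega>, a set that (A) and (B)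
  make finite. If the jets there are exact already, the residual vanishes on it and nothing
  obstructs the step. A genuine condition arises only at the start, for combinations vanishing at
  every \<open>lam n\<close>, and these live on D_M. Lacunarity enters through tails: without its
  first N factors the product is so close to 1 that its operator tends to the identity, while it
  maps the kernel into exponential sums with N terms. The frequencies \<xi>_l are points at which a
  basis of the vanishing quasi-polynomials is biorthogonal to evaluation.\<close>

lemma homogeneous_system_nontrivial:
  fixes A :: "'i \<Rightarrow> 'k \<Rightarrow> complex"
  assumes "finite J" "finite I" "card J < card I"
  shows "\<exists>a. (\<exists>i\<in>I. a i \<noteq> 0) \<and> (\<forall>k\<in>J. (\<Sum>i\<in>I. a i * A i k) = 0)"
  using assms
proof (induction J arbitrary: I A rule: finite_induct)
  case empty
  then obtain i where "i \<in> I" by (auto simp: card_gt_0_iff)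
  then show ?case by (intro exI[of _ "\<lambda>_. 1"]) auto
next
  case (insert k J)
  show ?case
  proof (cases "\<forall>i\<in>I. A i k = 0")
    case True
    have "card J < card I" using insert by simp
    from insert.IH[OF insert.prems(1) this] obtain a where
      "\<exists>i\<in>I. a i \<noteq> 0" "\<forall>k\<in>J. (\<Sum>i\<in>I. a i * A i k) = 0" by blast
    with True show ?thesis by (intro exI[of _ a]) auto
  next
    case False
    then obtain i0 where i0: "i0 \<in> I" "A i0 k \<noteq> 0" by blast
    define I' where "I' = I - {i0}"
    have I': "finite I'" "I = insert i0 I'" "i0 \<notin> I'"
      using insert.prems i0 by (auto simp: I'_def)
    have "card J < card I'" using insert I' by simp
    \<comment> \<open>Gaussian elimination: equation \<open>k\<close> has the pivot
      \<open>A i0 k\<close> and removes the unknown \<open>i0\<close>; the remaining equations are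
      taken after this substitution.\<close>
    from insert.IH[OF I'(1) this, of "\<lambda>i l. A i l - A i k / A i0 k * A i0 l"]
    obtain a where a: "\<exists>i\<in>I'. a i \<noteq> 0"
      and a0: "\<And>l. l \<in> J \<Longrightarrow> (\<Sum>i\<in>I'. a i * (A i l - A i k / A i0 k * A i0 l)) = 0"
      by blast
    define s where "s = - (\<Sum>i\<in>I'. a i * A i k) / A i0 k"
    define a' where "a' = a(i0 := s)"
    have sum: "(\<Sum>i\<in>I. a' i * A i l) = s * A i0 l + (\<Sum>i\<in>I'. a i * A i l)" for l
    proof -
      have "(\<Sum>i\<in>I'. a' i * A i l) = (\<Sum>i\<in>I'. a i * A i l)"
        using I' by (intro sum.cong) (auto simp: a'_def)
      then show ?thesis using I' by (simp add: a'_def)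
    qed
    have "(\<Sum>i\<in>I. a' i * A i l) = 0" if "l \<in> J" for l
    proof -
      have "(\<Sum>i\<in>I'. a i * (A i l - A i k / A i0 k * A i0 l))
          = (\<Sum>i\<in>I'. a i * A i l) - (\<Sum>i\<in>I'. a i * A i k * (A i0 l / A i0 k))"
        by (simp add: right_diff_distrib sum_subtractf mult.assoc)
      also have "(\<Sum>i\<in>I'. a i * A i k * (A i0 l / A i0 k)) = - s * A i0 l"
        unfolding sum_distrib_right[symmetric] s_def by simp
      finally show ?thesis using a0[OF that] unfolding sum by (simp add: add.commute)
    qed
    moreover have "(\<Sum>i\<in>I. a' i * A i k) = 0"
      unfolding sum using i0 by (simp add: s_def)
    moreover have "\<exists>i\<in>I. a' i \<noteq> 0" using a I' by (auto simp: a'_def)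
    ultimately show ?thesis by (intro exI[of _ a']) auto
  qed
qed

lemma lin_comb_in_subspace:
  assumes "(\<lambda>z. 0) \<in> V" "\<And>f g. f \<in> V \<Longrightarrow> g \<in> V \<Longrightarrow> (\<lambda>z. f z + g z) \<in> V"
    "\<And>c f. f \<in> V \<Longrightarrow> (\<lambda>z. c * f z) \<in> V" "\<And>i. i < d \<Longrightarrow> g i \<in> V"
  shows "lin_comb g d c \<in> V"
  using assms(4) unfolding lin_comb_def
proof (induction d)
  case (Suc d)
  then show ?case using assms(2)[OF _ assms(3)] by auto
qed (simp add: assms(1))

lemma has_dim_le:
  assumes "has_dim V d" "has_dim V d'"
  shows "d \<le> d'"
proof (rule ccontr)
  assume "\<not> d \<le> d'"
  from assms obtain g h where g: "\<And>i. i < d \<Longrightarrow> g i \<in> V" "lin_indep_fun g d"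
    and h: "V = span_fun h d'" unfolding has_dim_def by metis
  have "\<forall>i. \<exists>c. i < d \<longrightarrow> g i = lin_comb h d' c" using g(1) h by (auto simp: span_fun_def)
  then obtain A where A: "\<And>i. i < d \<Longrightarrow> g i = lin_comb h d' (A i)" by metis
  obtain a where a: "\<exists>i<d. a i \<noteq> 0" "\<And>k. k < d' \<Longrightarrow> (\<Sum>i<d. a i * A i k) = 0"
    using homogeneous_system_nontrivial[of "{..<d'}" "{..<d}" A] \<open>\<not> d \<le> d'\<close> by auto
  have "lin_comb g d a z = 0" for z
  proof -
    have "lin_comb g d a z = (\<Sum>i<d. \<Sum>k<d'. a i * A i k * h k z)"
      by (simp add: lin_comb_def A sum_distrib_left mult_ac)
    also have "\<dots> = (\<Sum>k<d'. (\<Sum>i<d. a i * A i k) * h k z)"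
      by (subst sum.swap) (simp add: sum_distrib_right)
    finally show ?thesis by (simp add: a)
  qed
  then show False using g(2) a(1) unfolding lin_indep_fun_def by (metis ext)
qed

lemma has_dim_unique: "has_dim V d \<Longrightarrow> has_dim V d' \<Longrightarrow> d = d'"
  by (meson has_dim_le antisym)

text \<open>A longest system of functions in \<open>V\<close> biorthogonal to points already
  reproduces \<open>V\<close>: the defect of an element that is not reproduced, scaled to 1 at a
  point where it is nonzero, would prolong the system. Point evaluations are chosen as dual
  functionals because the points become frequencies of exponentials.\<close>

lemma biorthogonal_basis_exists:
  fixes V :: "(complex \<Rightarrow> complex) set" and h :: "'k \<Rightarrow> complex \<Rightarrow> complex"
  assumes V: "(\<lambda>z. 0) \<in> V" "\<And>f g. f \<in> V \<Longrightarrow> g \<in> V \<Longrightarrow> (\<lambda>z. f z + g z) \<in> V"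
    "\<And>c f. f \<in> V \<Longrightarrow> (\<lambda>z. c * f z) \<in> V"
    and J: "finite J" "\<And>f. f \<in> V \<Longrightarrow> \<exists>c. f = (\<lambda>z. \<Sum>k\<in>J. c k * h k z)"
  obtains d g \<xi> where "\<And>i. i < d \<Longrightarrow> g i \<in> V"
    "\<And>i j. i < d \<Longrightarrow> j < d \<Longrightarrow> g i (\<xi> j) = of_bool (i = j)"
    "\<And>f. f \<in> V \<Longrightarrow> f = lin_comb g d (\<lambda>i. f (\<xi> i))" "has_dim V d"
proof -
  define P where "P d = (\<exists>g \<xi>. (\<forall>i<d. g i \<in> V) \<and> (\<forall>i<d. \<forall>j<d. g i (\<xi> j) = of_bool (i = j)))"
    for d :: nat
  have bound: "d \<le> card J" if "P d" for d
  proof (rule ccontr)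
    assume "\<not> d \<le> card J"
    from that obtain g \<xi> where g: "\<And>i. i < d \<Longrightarrow> g i \<in> V"
      and \<xi>: "\<And>i j. i < d \<Longrightarrow> j < d \<Longrightarrow> g i (\<xi> j) = of_bool (i = j)"
      unfolding P_def by blast
    have "\<forall>i. \<exists>c. i < d \<longrightarrow> g i = (\<lambda>z. \<Sum>k\<in>J. c k * h k z)" using g J(2) by blast
    then obtain A where A: "\<And>i. i < d \<Longrightarrow> g i = (\<lambda>z. \<Sum>k\<in>J. A i k * h k z)" by metis
    obtain a where a: "\<exists>i<d. a i \<noteq> 0" "\<And>k. k \<in> J \<Longrightarrow> (\<Sum>i<d. a i * A i k) = 0"
      using homogeneous_system_nontrivial[OF J(1), of "{..<d}" A] \<open>\<not> d \<le> card J\<close> by auto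
    have "a j = 0" if "j < d" for j
    proof -
      have "a j = (\<Sum>i<d. a i * g i (\<xi> j))" using that by (simp add: \<xi> if_distrib sum.delta cong: if_cong)
      also have "\<dots> = (\<Sum>i<d. \<Sum>k\<in>J. a i * A i k * h k (\<xi> j))"
        by (simp add: A sum_distrib_left mult_ac)
      also have "\<dots> = (\<Sum>k\<in>J. (\<Sum>i<d. a i * A i k) * h k (\<xi> j))"
        by (subst sum.swap) (simp add: sum_distrib_right)
      finally show ?thesis by (simp add: a)
    qed
    then show False using a(1) by auto
  qed
  have P0: "P 0" by (simp add: P_def)
  define d where "d = (GREATEST d. P d)"
  have Pd: "P d" unfolding d_def using P0 bound by (rule GreatestI_nat)
  have max: "\<not> P (Suc d)"
    using Greatest_le_nat[of P "Suc d" "card J"] bound unfolding d_def by auto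
  from Pd obtain g \<xi> where g: "\<And>i. i < d \<Longrightarrow> g i \<in> V"
    and \<xi>: "\<And>i j. i < d \<Longrightarrow> j < d \<Longrightarrow> g i (\<xi> j) = of_bool (i = j)"
    unfolding P_def by blast
  have rep: "f = lin_comb g d (\<lambda>i. f (\<xi> i))" if f: "f \<in> V" for f
  proof (rule ccontr)
    assume "f \<noteq> lin_comb g d (\<lambda>i. f (\<xi> i))"
    then obtain z0 where z0: "f z0 \<noteq> lin_comb g d (\<lambda>i. f (\<xi> i)) z0" by blast
    define u where "u = (\<lambda>z. inverse (f z0 - lin_comb g d (\<lambda>i. f (\<xi> i)) z0) *
      (f z + (-1) * lin_comb g d (\<lambda>i. f (\<xi> i)) z))"
    have lc: "lin_comb g d c \<in> V" for c using lin_comb_in_subspace[OF V] g by blast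
    have u: "u \<in> V" unfolding u_def by (intro V(2,3) f lc)
    have u0: "u (\<xi> j) = 0" if "j < d" for j
      using that by (simp add: u_def lin_comb_def \<xi> if_distrib sum.delta cong: if_cong)
    have u1: "u z0 = 1" using z0 by (simp add: u_def)
    \<comment> \<open>The old functions are corrected by multiples of \<open>u\<close> to vanish at
      the new point; \<open>u\<close> vanishes at the old points, so the old relations
      survive.\<close>
    define g' where "g' = (\<lambda>i. if i < d then (\<lambda>z. g i z + (- g i z0) * u z) else u)"
    define \<xi>' where "\<xi>' = (\<lambda>i. if i < d then \<xi> i else z0)"
    have "(\<lambda>z. g i z + (- g i z0) * u z) \<in> V" if "i < d" for i
      by (intro V(2,3) g u that)
    then have g': "\<forall>i<Suc d. g' i \<in> V" using u by (auto simp: g'_def)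
    have "P (Suc d)" unfolding P_def
      by (intro exI[of _ g'] exI[of _ \<xi>'] conjI g')
        (auto simp: g'_def \<xi>'_def u0 u1 \<xi> less_Suc_eq)
    with max show False by blast
  qed
  have "lin_indep_fun g d" unfolding lin_indep_fun_def
  proof (intro allI impI)
    fix c i assume c: "lin_comb g d c = (\<lambda>z. 0)" "i < d"
    have "c i = lin_comb g d c (\<xi> i)"
      using c(2) by (simp add: lin_comb_def \<xi> if_distrib sum.delta cong: if_cong)
    then show "c i = 0" using c by simp
  qed
  moreover have "V = span_fun g d"
    using rep lin_comb_in_subspace[OF V] g unfolding span_fun_def by blast
  ultimately have "has_dim V d" using g by (auto simp: has_dim_def)
  with g \<xi> rep that show thesis by blast
qed

section \<open>Small solutions of finitely many linear equations under a seminorm\<close>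

locale seminormed_space = vector_space scale
  for scale :: "complex \<Rightarrow> 'a::ab_group_add \<Rightarrow> 'a" (infixr \<open>*s\<close> 75) +
  fixes p :: "'a \<Rightarrow> real"
  assumes p_add: "p (x + y) \<le> p x + p y" and p_scale: "p (c *s x) = norm c * p x"
begin

lemma p_zero [simp]: "p 0 = 0"
  using p_scale[of 0 0] by simp

lemma p_diff: "p (x - y) \<le> p x + p y"
  using p_add[of x "(-1) *s y"] p_scale[of "-1" y] by simp

lemma p_nonneg: "p x \<ge> 0"
  using p_diff[of x x] by simp

lemma p_sum: "p (\<Sum>i\<in>I. f i) \<le> (\<Sum>i\<in>I. p (f i))"
proof (induction I rule: infinite_finite_induct)
  case (insert i I)
  then show ?case using p_add[of "f i" "sum f I"] by simp
qed auto

text \<open>Only \<open>p\<close>-bounded combinations can obstruct a solution of small seminorm.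
  The subspace varies in the induction on the number of functionals: a bounded combination is used
  up by restricting to its kernel; if there is none, a solution for one functional fewer is
  corrected inside the common kernel of the others, where the last functional is unbounded relative
  to \<open>p\<close>.\<close>

lemma small_simultaneous_solution:
  fixes T :: "'i \<Rightarrow> 'a \<Rightarrow> complex"
  assumes T_add: "\<And>i x y. T i (x + y) = T i x + T i y"
    and T_scale: "\<And>i c x. T i (c *s x) = c * T i x"
    and "finite F" "subspace X"
    and "\<And>a C. (\<And>x. x \<in> X \<Longrightarrow> norm (\<Sum>i\<in>F. a i * T i x) \<le> C * p x) \<Longrightarrow> (\<Sum>i\<in>F. a i * b i) = 0"
    and "\<epsilon> > 0"
  shows "\<exists>x\<in>X. (\<forall>i\<in>F. T i x = b i) \<and> p x < \<epsilon>"
  using assms(3-6)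
proof (induction "card F" arbitrary: F X b \<epsilon> rule: less_induct)
  case less
  note fin = \<open>finite F\<close> and sub = \<open>subspace X\<close> and ann = less.prems(3) and eps = \<open>\<epsilon> > 0\<close>
  have T_zero: "T i 0 = 0" for i using T_scale[of i 0 0] by simp
  have T_diff: "T i (x - y) = T i x - T i y" for i x y
    using T_add[of i "x - y" y] by simp
  have T_sum: "T i (\<Sum>k\<in>K. f k) = (\<Sum>k\<in>K. T i (f k))" for i f and K :: "'i set"
    by (induction K rule: infinite_finite_induct) (auto simp: T_zero T_add)
  show ?case
  proof (cases "F = {}")
    case True
    then show ?thesis using eps subspace_0[OF sub] by (intro bexI[of _ 0]) auto
  next
    case False
    show ?thesis
    proof (cases "\<exists>a C j. j \<in> F \<and> a j \<noteq> 0 \<and> (\<forall>x\<in>X. norm (\<Sum>i\<in>F. a i * T i x) \<le> C * p x)")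
      case True
      then obtain a C j where j: "j \<in> F" "a j \<noteq> 0"
        and bd: "\<And>x. x \<in> X \<Longrightarrow> norm (\<Sum>i\<in>F. a i * T i x) \<le> C * p x" by blast
      define S where "S = (\<lambda>x. \<Sum>i\<in>F. a i * T i x)"
      define F' where "F' = F - {j}"
      define X' where "X' = {x\<in>X. S x = 0}"
      have F': "finite F'" "F = insert j F'" "j \<notin> F'" "card F' < card F"
        using fin j by (auto simp: F'_def intro!: psubset_card_mono simp del: card_Diff_insert card_Diff_singleton)
      have S_add: "S (x + y) = S x + S y" for x y
        by (simp add: S_def T_add distrib_left sum.distrib)
      have S_scale: "S (c *s x) = c * S x" for c x
        by (simp add: S_def T_scale sum_distrib_left mult_ac)
      have S_diff: "S (x - y) = S x - S y" for x y
        using S_add[of "x - y" y] by simp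
      have sub': "subspace X'"
        using sub S_scale[of 0 0] by (auto simp: X'_def subspace_def S_add S_scale)
      \<comment> \<open>A functional bounded on the kernel of the bounded \<open>S\<close> is
        bounded on all of \<open>X\<close>: subtract from \<open>x\<close> the multiple
        \<open>S x\<close> of a fixed \<open>x0\<close> with \<open>S x0 = 1\<close>. Hence the
        hypothesis on \<open>X\<close> passes to \<open>X'\<close>.\<close>
      have ann': "(\<Sum>i\<in>F'. a' i * b i) = 0"
        if bd': "\<And>x. x \<in> X' \<Longrightarrow> norm (\<Sum>i\<in>F'. a' i * T i x) \<le> C' * p x" for a' C'
      proof -
        define U where "U = (\<lambda>x. \<Sum>i\<in>F'. a' i * T i x)"
        have U_add: "U (x + y) = U x + U y" for x y
          by (simp add: U_def T_add distrib_left sum.distrib)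
        have U_scale: "U (c *s x) = c * U x" for c x
          by (simp add: U_def T_scale sum_distrib_left mult_ac)
        have bdU: "norm (U x) \<le> \<bar>C'\<bar> * p x" if "x \<in> X'" for x
          using bd'[OF that] mult_right_mono[OF abs_ge_self[of C'] p_nonneg[of x]]
          unfolding U_def by linarith
        have "\<exists>K. \<forall>x\<in>X. norm (U x) \<le> K * p x"
        proof (cases "\<forall>x\<in>X. S x = 0")
          case True
          then have "X' = X" by (auto simp: X'_def)
          then show ?thesis using bdU by blast
        next
          case False
          then obtain x1 where x1: "x1 \<in> X" "S x1 \<noteq> 0" by blast
          define x0 where "x0 = inverse (S x1) *s x1"
          have x0: "x0 \<in> X" "S x0 = 1"
            using x1 sub by (auto simp: x0_def S_scale subspace_scale)
          show ?thesis
          proof (intro exI ballI)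
            fix x assume x: "x \<in> X"
            define y where "y = x - S x *s x0"
            have y: "y \<in> X'" using x x0 sub
              by (auto simp: X'_def y_def S_diff S_scale subspace_diff subspace_scale)
            have "U x = U y + S x * U x0"
              using U_add[of y "S x *s x0"] by (simp add: y_def U_scale)
            then have "norm (U x) \<le> norm (U y) + norm (S x) * norm (U x0)"
              by (metis norm_triangle_ineq norm_mult)
            also have "norm (U y) \<le> \<bar>C'\<bar> * (p x + norm (S x) * p x0)"
              using bdU[OF y] p_diff[of x "S x *s x0"] unfolding y_def p_scale
              by (meson abs_ge_zero mult_left_mono order_trans)
            also have "\<bar>C'\<bar> * (p x + norm (S x) * p x0) + norm (S x) * norm (U x0)
              = \<bar>C'\<bar> * p x + norm (S x) * (\<bar>C'\<bar> * p x0 + norm (U x0))"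
              by (simp add: algebra_simps)
            also have "\<dots> \<le> \<bar>C'\<bar> * p x + (C * p x) * (\<bar>C'\<bar> * p x0 + norm (U x0))"
              using bd[OF x] p_nonneg[of x0]
              by (intro add_left_mono mult_right_mono) (auto simp: S_def)
            finally show "norm (U x) \<le> (\<bar>C'\<bar> + C * (\<bar>C'\<bar> * p x0 + norm (U x0))) * p x"
              by (simp add: algebra_simps)
          qed
        qed
        then obtain K where K: "\<And>x. x \<in> X \<Longrightarrow> norm (U x) \<le> K * p x" by blast
        define a'' where "a'' = a'(j := 0)"
        have ext: "(\<Sum>i\<in>F. a'' i * h i) = (\<Sum>i\<in>F'. a' i * h i)" for h :: "'i \<Rightarrow> complex"
          unfolding F'(2) using F' by (auto simp: a''_def intro!: sum.cong)
        show ?thesis using ann[of a'' K] K by (simp add: ext U_def)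
      qed
      have "\<exists>x\<in>X'. (\<forall>i\<in>F'. T i x = b i) \<and> p x < \<epsilon>"
        by (rule less.hyps[OF F'(4) F'(1) sub' _ eps]) (rule ann')
      then obtain x where x: "x \<in> X'" "\<forall>i\<in>F'. T i x = b i" "p x < \<epsilon>" by blast
      \<comment> \<open>The equation for \<open>j\<close> comes for free: the values
        \<open>b i\<close> and \<open>T i x\<close> satisfy the same relation with coefficients
        \<open>a\<close>, and \<open>a j\<close> is nonzero.\<close>
      have "(\<Sum>i\<in>F. a i * b i) = 0" using ann bd by blast
      moreover have "(\<Sum>i\<in>F. a i * T i x) = 0" using x(1) by (simp add: X'_def S_def)
      moreover have "(\<Sum>i\<in>F'. a i * T i x) = (\<Sum>i\<in>F'. a i * b i)" using x(2) by simp
      ultimately have "a j * T j x = a j * b j" using F' by (simp add: add_eq_0_iff2)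
      then have "T j x = b j" using j by simp
      then show ?thesis using x F'(2) by (auto simp: X'_def)
    next
      case False
      then have indep: "a j = 0"
        if "j \<in> F" "\<And>x. x \<in> X \<Longrightarrow> norm (\<Sum>i\<in>F. a i * T i x) \<le> C * p x" for a C j
        using that by blast
      obtain j where j: "j \<in> F" using \<open>F \<noteq> {}\<close> by blast
      define F' where "F' = F - {j}"
      have F': "finite F'" "F = insert j F'" "j \<notin> F'" "card F' < card F"
        using fin j by (auto simp: F'_def intro!: psubset_card_mono simp del: card_Diff_insert card_Diff_singleton)
      have solve: "\<exists>x\<in>X. (\<forall>i\<in>F'. T i x = b' i) \<and> p x < e" if "e > 0" for b' e
      proof (rule less.hyps[OF F'(4) F'(1) sub _ that])
        fix a C assume bd: "\<And>x. x \<in> X \<Longrightarrow> norm (\<Sum>i\<in>F'. a i * T i x) \<le> C * p x"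
        define a' where "a' = a(j := 0)"
        have ext: "(\<Sum>i\<in>F. a' i * h i) = (\<Sum>i\<in>F'. a i * h i)" for h :: "'i \<Rightarrow> complex"
          unfolding F'(2) using F' by (auto simp: a'_def intro!: sum.cong)
        have "a' i = 0" if "i \<in> F" for i
          using indep[OF that, of a' C] bd by (simp add: ext)
        then have "a i = 0" if "i \<in> F'" for i
          using that F' by (metis a'_def fun_upd_other insertCI)
        then show "(\<Sum>i\<in>F'. a i * b' i) = 0" by simp
      qed
      define Y where "Y = {x\<in>X. \<forall>i\<in>F'. T i x = 0}"
      \<comment> \<open>Otherwise take vectors \<open>c i n\<close> dual to the remaining
        functionals, of seminorm below 1 / (n + 1). Their differences lie in \<open>Y\<close>, so
        \<open>T j (c i n)\<close> converges to some \<open>\<alpha> i\<close>, and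
        \<open>T j\<close> minus the sum of the \<open>\<alpha> i\<close> times \<open>T i\<close>
        is bounded on \<open>X\<close>, against the independence modulo bounded functionals.\<close>
      have "\<exists>y\<in>Y. norm (T j y) > C * p y" for C
      proof (rule ccontr)
        assume "\<not> (\<exists>y\<in>Y. norm (T j y) > C * p y)"
        then have "norm (T j y) \<le> C * p y" if "y \<in> Y" for y using that by force
        then have bd: "norm (T j y) \<le> \<bar>C\<bar> * p y" if "y \<in> Y" for y
          using that mult_right_mono[OF abs_ge_self[of C] p_nonneg[of y]] by (meson order_trans)
        have "\<forall>i n. \<exists>x\<in>X. (\<forall>i'\<in>F'. T i' x = of_bool (i' = i)) \<and> p x < inverse (real (Suc n))"
          using solve by simp
        then obtain c where c: "\<And>i n. c i n \<in> X"
            "\<And>i n i'. i' \<in> F' \<Longrightarrow> T i' (c i n) = of_bool (i' = i)"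
            "\<And>i n. p (c i n) < inverse (real (Suc n))" by metis
        have Cau: "Cauchy (\<lambda>n. T j (c i n))" for i
        proof (rule CauchyI')
          fix e :: real assume "e > 0"
          \<comment> \<open>The summand 1 keeps the denominator positive when \<open>C\<close> is
            zero.\<close>
          obtain N where "inverse (real (Suc N)) < e / (2 * \<bar>C\<bar> + 1)"
            using reals_Archimedean[of "e / (2 * \<bar>C\<bar> + 1)"] \<open>e > 0\<close> by (auto simp: add_nonneg_pos)
          then have "(2 * \<bar>C\<bar> + 1) * inverse (real (Suc N)) < e"
            by (simp add: pos_less_divide_eq add_nonneg_pos mult.commute del: of_nat_Suc)
          moreover have "0 \<le> inverse (real (Suc N))" by simp
          ultimately have N: "(2 * \<bar>C\<bar>) * inverse (real (Suc N)) < e"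
            unfolding distrib_right by linarith
          show "\<exists>M. \<forall>n\<ge>M. \<forall>m>n. dist (T j (c i n)) (T j (c i m)) < e"
            unfolding dist_norm
          proof (intro exI allI impI)
            fix n m assume nm: "N \<le> n" "n < m"
            have "c i n - c i m \<in> Y" using c sub by (auto simp: Y_def subspace_diff T_diff)
            from bd[OF this] have "norm (T j (c i n) - T j (c i m)) \<le> \<bar>C\<bar> * (p (c i n) + p (c i m))"
              using p_diff[of "c i n" "c i m"] unfolding T_diff
              by (meson abs_ge_zero mult_left_mono order_trans)
            also have "\<dots> \<le> \<bar>C\<bar> * (inverse (real (Suc N)) + inverse (real (Suc N)))"
            proof (intro mult_left_mono add_mono)
              show "p (c i n) \<le> inverse (real (Suc N))" "p (c i m) \<le> inverse (real (Suc N))"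
                using c(3)[of i n] c(3)[of i m] nm
                by (auto intro!: order_trans[OF less_imp_le[OF c(3)]] le_imp_inverse_le)
            qed auto
            also have "\<dots> < e" using N by simp
            finally show "norm (T j (c i n) - T j (c i m)) < e" .
          qed
        qed
        define \<alpha> where "\<alpha> = (\<lambda>i. lim (\<lambda>n. T j (c i n)))"
        have \<alpha>: "(\<lambda>n. T j (c i n)) \<longlonglongrightarrow> \<alpha> i" for i
          using Cau[of i] Cauchy_convergent_iff convergent_LIMSEQ_iff \<alpha>_def by blast
        define a where "a = (\<lambda>i. if i = j then 1 else - \<alpha> i)"
        have "norm (\<Sum>i\<in>F. a i * T i x) \<le> \<bar>C\<bar> * p x" if x: "x \<in> X" for x
        proof (rule LIMSEQ_le)
          have "(\<Sum>i\<in>F'. a i * T i x) = (\<Sum>i\<in>F'. - (T i x * \<alpha> i))"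
            using F'(3) by (intro sum.cong) (auto simp: a_def)
          then have eq: "(\<Sum>i\<in>F. a i * T i x) = T j x - (\<Sum>i\<in>F'. T i x * \<alpha> i)"
            using F' by (simp add: a_def sum_negf)
          show "(\<lambda>n. norm (T j x - (\<Sum>i\<in>F'. T i x * T j (c i n)))) \<longlonglongrightarrow> norm (\<Sum>i\<in>F. a i * T i x)"
            unfolding eq by (intro tendsto_intros \<alpha>)
          have "(\<lambda>n. \<bar>C\<bar> * (p x + (\<Sum>i\<in>F'. norm (T i x) * inverse (real (Suc n)))))
             \<longlonglongrightarrow> \<bar>C\<bar> * (p x + (\<Sum>i\<in>F'. norm (T i x) * 0))"
            by (intro tendsto_intros LIMSEQ_inverse_real_of_nat)
          then show "(\<lambda>n. \<bar>C\<bar> * (p x + (\<Sum>i\<in>F'. norm (T i x) * inverse (real (Suc n)))))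
             \<longlonglongrightarrow> \<bar>C\<bar> * p x" by simp
          show "\<exists>N. \<forall>n\<ge>N. norm (T j x - (\<Sum>i\<in>F'. T i x * T j (c i n)))
              \<le> \<bar>C\<bar> * (p x + (\<Sum>i\<in>F'. norm (T i x) * inverse (real (Suc n))))"
          proof (intro exI allI impI)
            fix n :: nat
            define y where "y = x - (\<Sum>i\<in>F'. T i x *s c i n)"
            have "y \<in> X" unfolding y_def using x c(1) sub
              by (intro subspace_diff subspace_sum subspace_scale) auto
            moreover have "T k y = 0" if "k \<in> F'" for k
              using that F'(1) by (simp add: y_def T_diff T_sum T_scale c(2) if_distrib sum.delta cong: if_cong)
            ultimately have "y \<in> Y" by (simp add: Y_def)
            have "T j y = T j x - (\<Sum>i\<in>F'. T i x * T j (c i n))"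
              by (simp add: y_def T_diff T_sum T_scale)
            then have "norm (T j x - (\<Sum>i\<in>F'. T i x * T j (c i n))) \<le> \<bar>C\<bar> * p y"
              using bd[OF \<open>y \<in> Y\<close>] by simp
            also have "p y \<le> p x + (\<Sum>i\<in>F'. p (T i x *s c i n))"
              unfolding y_def using p_diff[of x "\<Sum>i\<in>F'. T i x *s c i n"]
                p_sum[of "\<lambda>i. T i x *s c i n" F'] by linarith
            also have "\<dots> \<le> p x + (\<Sum>i\<in>F'. norm (T i x) * inverse (real (Suc n)))"
              unfolding p_scale using c(3)
              by (intro add_left_mono sum_mono mult_left_mono) (auto intro: less_imp_le)
            finally show "norm (T j x - (\<Sum>i\<in>F'. T i x * T j (c i n)))
              \<le> \<bar>C\<bar> * (p x + (\<Sum>i\<in>F'. norm (T i x) * inverse (real (Suc n))))"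
              by (simp add: mult_left_mono)
          qed
        qed
        from indep[OF j this] show False by (simp add: a_def)
      qed
      note unbd = this
      obtain x where x: "x \<in> X" "\<forall>i\<in>F'. T i x = b i" "p x < \<epsilon> / 2"
        using solve[of "\<epsilon> / 2" b] eps by auto
      define \<beta> where "\<beta> = b j - T j x"
      \<comment> \<open>With this \<open>C\<close>, rescaling \<open>y\<close> to the value
        \<open>\<beta>\<close> of \<open>T j\<close> gives seminorm below half of
        \<open>\<epsilon>\<close>; the summand 1 makes the bound strict and \<open>C\<close>
        positive even for \<open>\<beta> = 0\<close>.\<close>
      define C where "C = 2 * (norm \<beta> + 1) / \<epsilon>"
      have C: "C > 0" using eps by (simp add: C_def add_nonneg_pos)
      obtain y where y: "y \<in> Y" "norm (T j y) > C * p y" using unbd by blast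
      have Ty: "norm (T j y) > 0"
        using y(2) C p_nonneg[of y] by (meson mult_nonneg_nonneg le_less_trans less_imp_le)
      define w where "w = (\<beta> / T j y) *s y"
      have "w \<in> Y" using y(1) sub by (auto simp: w_def Y_def T_scale subspace_scale)
      have Tw: "T j w = \<beta>" using Ty by (simp add: w_def T_scale)
      have "p w = norm \<beta> * (p y / norm (T j y))" by (simp add: w_def p_scale norm_divide)
      also have "\<dots> \<le> norm \<beta> * (1 / C)"
        using y(2) C Ty by (intro mult_left_mono) (auto simp: field_simps)
      also have "\<dots> < \<epsilon> / 2"
      proof -
        have "\<epsilon> / 2 * C = norm \<beta> + 1" using eps by (simp add: C_def)
        then show ?thesis using C by (simp add: pos_divide_less_eq)
      qed
      finally have "p w < \<epsilon> / 2" .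
      then have "p (x + w) < \<epsilon>" using x(3) p_add[of x w] by linarith
      moreover have "x + w \<in> X" using x \<open>w \<in> Y\<close> sub by (auto simp: Y_def subspace_add)
      moreover have "T i (x + w) = b i" if "i \<in> F" for i
        using that x(2) \<open>w \<in> Y\<close> Tw F'(2) by (auto simp: T_add Y_def \<beta>_def)
      ultimately show ?thesis by blast
    qed
  qed
qed

end

section \<open>Growth of quasi-polynomials along a direction\<close>

text \<open>Two readings are used: a quasi-polynomial in \<open>z\<close>, and the value on the
  exponential with frequency \<open>z\<close> of the functional that sums
  \<open>c (\<mu>, j)\<close> times the j-th derivative at \<mu>.\<close>

definition exp_poly :: "(complex \<times> nat) set \<Rightarrow> (complex \<times> nat \<Rightarrow> complex) \<Rightarrow> complex \<Rightarrow> complex" where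
  "exp_poly I c z = (\<Sum>(\<mu>, j)\<in>I. c (\<mu>, j) * z ^ j * exp (\<mu> * z))"

lemma Re_mult_direction:
  fixes x :: complex
  assumes "x \<noteq> 0"
  shows "Re (\<nu> * x) = norm x * Re (x / complex_of_real (norm x) * \<nu>)"
proof -
  have "x / complex_of_real (norm x) * \<nu> = \<nu> * x / complex_of_real (norm x)" by simp
  then show ?thesis using assms by (simp only: Re_divide_of_real) simp
qed

lemma power_exp_tendsto_zero:
  fixes x :: "nat \<Rightarrow> complex"
  assumes x: "filterlim x at_infinity sequentially"
    and dir: "(\<lambda>k. x k / complex_of_real (norm (x k))) \<longlonglongrightarrow> \<omega>"
    and neg: "Re (\<omega> * \<nu>) < 0"
  shows "(\<lambda>k. x k ^ j * exp (\<nu> * x k)) \<longlonglongrightarrow> 0"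
proof -
  \<comment> \<open>Half of the limiting rate of decay: eventually the exponential is at most
    \<open>exp (- e * norm (x k))\<close>, which beats every power.\<close>
  define e where "e = - Re (\<omega> * \<nu>) / 2"
  have e: "e > 0" using neg by (simp add: e_def)
  have nrm: "filterlim (\<lambda>k. norm (x k)) at_top sequentially"
    using filterlim_at_infinity_imp_norm_at_top[OF x] .
  have "(\<lambda>k. Re (x k / complex_of_real (norm (x k)) * \<nu>)) \<longlonglongrightarrow> Re (\<omega> * \<nu>)"
    by (intro tendsto_intros dir)
  then have "eventually (\<lambda>k. Re (x k / complex_of_real (norm (x k)) * \<nu>) < -e) sequentially"
    by (rule order_tendstoD) (use neg in \<open>unfold e_def, linarith\<close>)
  moreover have "eventually (\<lambda>k. norm (x k) > 0) sequentially"
    using nrm[unfolded filterlim_at_top_dense] by blast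
  ultimately have ev: "eventually (\<lambda>k. norm (x k ^ j * exp (\<nu> * x k))
      \<le> norm (x k) ^ j * exp (- e * norm (x k))) sequentially"
  proof eventually_elim
    case (elim k)
    have "Re (\<nu> * x k) = norm (x k) * Re (x k / complex_of_real (norm (x k)) * \<nu>)"
      using elim(2) by (intro Re_mult_direction) auto
    also have "\<dots> \<le> norm (x k) * (-e)"
      using elim by (intro mult_left_mono) auto
    finally have "Re (\<nu> * x k) \<le> - e * norm (x k)" by (simp add: mult.commute)
    then show ?case by (simp add: norm_mult norm_power mult_left_mono)
  qed
  have "((\<lambda>t::real. t ^ j * exp (- e * t)) \<longlongrightarrow> 0) at_top"
  proof -
    have "filterlim (\<lambda>t. e * t) at_top at_top"
      using e by (intro filterlim_tendsto_pos_mult_at_top[OF tendsto_const] filterlim_ident)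
    from filterlim_compose[OF tendsto_power_div_exp_0 this, of j]
    have "((\<lambda>t. inverse (e ^ j) * ((e * t) ^ j / exp (e * t))) \<longlongrightarrow> inverse (e ^ j) * 0) at_top"
      by (intro tendsto_intros)
    then show ?thesis using e by (simp add: field_simps exp_minus power_mult_distrib)
  qed
  from filterlim_compose[OF this nrm]
  have "(\<lambda>k. norm (x k) ^ j * exp (- e * norm (x k))) \<longlonglongrightarrow> 0" .
  then show ?thesis using ev by (rule Lim_null_comparison[rotated])
qed

lemma exp_poly_leading_term:
  fixes x :: "nat \<Rightarrow> complex"
  assumes x: "filterlim x at_infinity sequentially"
    and dir: "(\<lambda>k. x k / complex_of_real (norm (x k))) \<longlonglongrightarrow> \<omega>"
    and I: "finite I" "(\<mu>0, J) \<in> I"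
    and dom: "\<And>\<mu> j. (\<mu>, j) \<in> I \<Longrightarrow> c (\<mu>, j) \<noteq> 0 \<Longrightarrow> (\<mu>, j) \<noteq> (\<mu>0, J) \<Longrightarrow>
      Re (\<omega> * \<mu>) < Re (\<omega> * \<mu>0) \<or> \<mu> = \<mu>0 \<and> j < J"
  shows "(\<lambda>k. exp_poly I c (x k) / (x k ^ J * exp (\<mu>0 * x k))) \<longlonglongrightarrow> c (\<mu>0, J)"
proof -
  have nrm: "filterlim (\<lambda>k. norm (x k)) at_top sequentially"
    using filterlim_at_infinity_imp_norm_at_top[OF x] .
  have ev1: "eventually (\<lambda>k. norm (x k) > 1) sequentially"
    using nrm[unfolded filterlim_at_top_dense] by blast
  have "(\<lambda>k. c i * x k ^ snd i * exp (fst i * x k) / (x k ^ J * exp (\<mu>0 * x k)))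
     \<longlonglongrightarrow> (if i = (\<mu>0, J) then c (\<mu>0, J) else 0)" if i: "i \<in> I" for i
  proof -
    obtain \<mu> j where ij: "i = (\<mu>, j)" by force
    consider "c i = 0" | "i = (\<mu>0, J)" | "c i \<noteq> 0" "\<mu> = \<mu>0" "j < J" |
      "c i \<noteq> 0" "Re (\<omega> * \<mu>) < Re (\<omega> * \<mu>0)"
      using dom[of \<mu> j] i ij by blast
    then show ?thesis
    proof cases
      case 1 then show ?thesis by auto
    next
      case 2
      have "eventually (\<lambda>k. c i * x k ^ snd i * exp (fst i * x k) / (x k ^ J * exp (\<mu>0 * x k)) = c i) sequentially"
        using ev1 by eventually_elim (auto simp: 2)
      then show ?thesis using 2 by (auto intro: tendsto_eventually)
    next
      case 3
      have "(\<lambda>k. c i * (inverse (x k)) ^ (J - j)) \<longlonglongrightarrow> c i * 0 ^ (J - j)"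
        by (intro tendsto_intros tendsto_inverse_0[THEN filterlim_compose] x)
      moreover have "eventually (\<lambda>k. c i * (inverse (x k)) ^ (J - j) =
          c i * x k ^ snd i * exp (fst i * x k) / (x k ^ J * exp (\<mu>0 * x k))) sequentially"
        using ev1
      proof eventually_elim
        case (elim k)
        then have "x k \<noteq> 0" by auto
        moreover have "x k ^ J = x k ^ j * x k ^ (J - j)"
          using 3 by (simp flip: power_add)
        ultimately show ?case using 3 by (simp add: ij field_simps)
      qed
      ultimately have "(\<lambda>k. c i * x k ^ snd i * exp (fst i * x k) / (x k ^ J * exp (\<mu>0 * x k)))
          \<longlonglongrightarrow> c i * 0 ^ (J - j)" by (rule Lim_transform_eventually)
      then show ?thesis using 3 ij by (simp add: power_0_left)
    next
      \<comment> \<open>A power j above J does no harm, since the exponential gap absorbs it;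
        division by \<open>x k ^ J\<close> only helps once \<open>norm (x k) > 1\<close>.\<close>
      case 4
      have "Re (\<omega> * (\<mu> - \<mu>0)) < 0" using 4 by (simp add: algebra_simps)
      from power_exp_tendsto_zero[OF x dir this, of j]
      have lim: "(\<lambda>k. c i * (x k ^ j * exp ((\<mu> - \<mu>0) * x k))) \<longlonglongrightarrow> c i * 0"
        by (intro tendsto_intros)
      have "eventually (\<lambda>k. norm (c i * x k ^ snd i * exp (fst i * x k) / (x k ^ J * exp (\<mu>0 * x k)))
         \<le> norm (c i * (x k ^ j * exp ((\<mu> - \<mu>0) * x k)))) sequentially"
        using ev1
      proof eventually_elim
        case (elim k)
        have "norm (x k ^ J) \<ge> 1" using elim by (simp add: norm_power one_le_power)
        moreover have "c i * x k ^ snd i * exp (fst i * x k) / (x k ^ J * exp (\<mu>0 * x k))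
          = c i * (x k ^ j * exp ((\<mu> - \<mu>0) * x k)) / x k ^ J"
          unfolding left_diff_distrib exp_diff by (simp add: ij mult_ac)
        ultimately show ?case
          using frac_le[OF norm_ge_zero[of "c i * (x k ^ j * exp ((\<mu> - \<mu>0) * x k))"] order_refl zero_less_one]
          by (simp only: norm_divide div_by_1)
      qed
      then have "(\<lambda>k. c i * x k ^ snd i * exp (fst i * x k) / (x k ^ J * exp (\<mu>0 * x k))) \<longlonglongrightarrow> 0"
        by (rule Lim_null_comparison) (use tendsto_norm_zero[OF lim[simplified]] in simp)
      then show ?thesis using 4 ij by auto
    qed
  qed
  then have "(\<lambda>k. \<Sum>i\<in>I. c i * x k ^ snd i * exp (fst i * x k) / (x k ^ J * exp (\<mu>0 * x k)))
     \<longlonglongrightarrow> (\<Sum>i\<in>I. if i = (\<mu>0, J) then c (\<mu>0, J) else 0)"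
    by (rule tendsto_sum)
  moreover have "(\<Sum>i\<in>I. if i = (\<mu>0, J) then c (\<mu>0, J) else 0) = c (\<mu>0, J)"
    using I by (simp add: sum.delta')
  ultimately show ?thesis by (simp add: exp_poly_def sum_divide_distrib case_prod_beta)
qed

text \<open>If the largest Re (\<omega>\<mu>) over the active frequencies exceeds \<kappa>, the line
  condition leaves one frequency attaining it, so the leading term cannot be cancelled; if it also
  exceeds r, this term outgrows the assumed bound.\<close>

lemma exp_poly_bounded_support:
  fixes x :: "nat \<Rightarrow> complex"
  assumes x: "filterlim x at_infinity sequentially"
    and dir: "(\<lambda>k. x k / complex_of_real (norm (x k))) \<longlonglongrightarrow> \<omega>"
    and I: "finite I" "fst ` I \<subseteq> M" and line: "line_cond M \<omega> \<kappa>"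
    and bd: "\<And>k. norm (exp_poly I c (x k)) \<le> C * exp (r * norm (x k))"
    and i: "(\<mu>, j) \<in> I" "c (\<mu>, j) \<noteq> 0"
  shows "Re (\<omega> * \<mu>) \<le> max r \<kappa>"
proof (rule ccontr)
  assume neg: "\<not> Re (\<omega> * \<mu>) \<le> max r \<kappa>"
  define A where "A = {i\<in>I. c i \<noteq> 0}"
  have A: "finite A" "(\<mu>, j) \<in> A" using I i by (auto simp: A_def)
  define m where "m = Max ((\<lambda>i. Re (\<omega> * fst i)) ` A)"
  have "m \<in> (\<lambda>i. Re (\<omega> * fst i)) ` A" unfolding m_def using A by (intro Max_in) auto
  then obtain \<mu>0 j0 where \<mu>0: "(\<mu>0, j0) \<in> A" "Re (\<omega> * \<mu>0) = m" by auto
  have m: "Re (\<omega> * \<mu>') \<le> m" if "(\<mu>', j') \<in> A" for \<mu>' j'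
    unfolding m_def using that A by (intro Max_ge) force+
  have big: "m > max r \<kappa>" using m[OF A(2)] neg by linarith
  define J where "J = Max {j. (\<mu>0, j) \<in> A}"
  have finJ: "finite {j. (\<mu>0, j) \<in> A}"
    by (rule finite_subset[OF _ finite_imageI[OF A(1), of snd]]) force
  have J: "(\<mu>0, J) \<in> A" using Max_in[OF finJ] \<mu>0 unfolding J_def by auto
  have J': "j' \<le> J" if "(\<mu>0, j') \<in> A" for j'
    unfolding J_def using that finJ by (intro Max_ge) auto
  have lim: "(\<lambda>k. exp_poly I c (x k) / (x k ^ J * exp (\<mu>0 * x k))) \<longlonglongrightarrow> c (\<mu>0, J)"
  proof (rule exp_poly_leading_term[OF x dir I(1)])
    show "(\<mu>0, J) \<in> I" using J by (simp add: A_def)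
    fix \<mu>' j' assume *: "(\<mu>', j') \<in> I" "c (\<mu>', j') \<noteq> 0" "(\<mu>', j') \<noteq> (\<mu>0, J)"
    then have inA: "(\<mu>', j') \<in> A" by (simp add: A_def)
    show "Re (\<omega> * \<mu>') < Re (\<omega> * \<mu>0) \<or> \<mu>' = \<mu>0 \<and> j' < J"
    proof (cases "Re (\<omega> * \<mu>') = m")
      case True
      have "\<mu>' \<in> M" "\<mu>0 \<in> M" using I(2) inA J by (force simp: A_def)+
      then have "\<mu>' = \<mu>0"
        using line big True \<mu>0(2) unfolding line_cond_def at_most_one_node_def line_def by auto
      then show ?thesis using J' inA *(3) by force
    qed (use m[OF inA] \<mu>0 in auto)
  qed
  have nrm: "filterlim (\<lambda>k. norm (x k)) at_top sequentially"
    using filterlim_at_infinity_imp_norm_at_top[OF x] .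
  have ev1: "eventually (\<lambda>k. norm (x k) > 1) sequentially"
    using nrm[unfolded filterlim_at_top_dense] by blast
  \<comment> \<open>Half of the gap between the growth rates: eventually the leading exponential has
    rate above \<open>r + s\<close>, the midpoint of \<open>r\<close> and \<open>m\<close>.\<close>
  define s where "s = (m - r) / 2"
  have s: "s > 0" using big by (simp add: s_def)
  have "(\<lambda>k. Re (x k / complex_of_real (norm (x k)) * \<mu>0)) \<longlonglongrightarrow> Re (\<omega> * \<mu>0)"
    by (intro tendsto_intros dir)
  then have "eventually (\<lambda>k. Re (x k / complex_of_real (norm (x k)) * \<mu>0) > r + s) sequentially"
    by (rule order_tendstoD) (use s \<mu>0(2) in \<open>simp add: s_def field_simps\<close>)
  then have "eventually (\<lambda>k. norm (exp_poly I c (x k) / (x k ^ J * exp (\<mu>0 * x k)))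
     \<le> \<bar>C\<bar> * exp (- s * norm (x k))) sequentially"
    using ev1
  proof eventually_elim
    case (elim k)
    have "Re (\<mu>0 * x k) = norm (x k) * Re (x k / complex_of_real (norm (x k)) * \<mu>0)"
      using elim(2) by (intro Re_mult_direction) auto
    also have "\<dots> \<ge> norm (x k) * (r + s)"
      using elim by (intro mult_left_mono) auto
    finally have *: "(r + s) * norm (x k) \<le> Re (\<mu>0 * x k)" by (simp add: mult.commute)
    have "norm (exp_poly I c (x k) / (x k ^ J * exp (\<mu>0 * x k)))
      = norm (exp_poly I c (x k)) / (norm (x k) ^ J * exp (Re (\<mu>0 * x k)))"
      by (simp add: norm_divide norm_mult norm_power)
    also have "\<dots> \<le> (\<bar>C\<bar> * exp (r * norm (x k))) / (1 * exp ((r + s) * norm (x k)))"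
    proof (rule frac_le)
      show "norm (exp_poly I c (x k)) \<le> \<bar>C\<bar> * exp (r * norm (x k))"
        using bd[of k] mult_right_mono[OF abs_ge_self[of C], of "exp (r * norm (x k))"]
        by (meson exp_ge_zero order_trans)
      show "1 * exp ((r + s) * norm (x k)) \<le> norm (x k) ^ J * exp (Re (\<mu>0 * x k))"
        using * elim by (intro mult_mono) (auto intro: one_le_power)
    qed auto
    also have "\<dots> = \<bar>C\<bar> * exp (- s * norm (x k))"
      by (simp add: distrib_right exp_add exp_minus inverse_eq_divide)
    finally show ?case .
  qed
  moreover have "(\<lambda>k. \<bar>C\<bar> * exp (- s * norm (x k))) \<longlonglongrightarrow> \<bar>C\<bar> * 0"
  proof (intro tendsto_mult_left filterlim_compose[OF exp_at_bot])
    show "filterlim (\<lambda>k. - s * norm (x k)) at_bot sequentially"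
      using s by (intro filterlim_tendsto_neg_mult_at_bot[OF tendsto_const] nrm) auto
  qed
  ultimately have "(\<lambda>k. exp_poly I c (x k) / (x k ^ J * exp (\<mu>0 * x k))) \<longlonglongrightarrow> 0"
    unfolding mult_zero_right by (rule Lim_null_comparison)
  with lim have "c (\<mu>0, J) = 0" using LIMSEQ_unique by blast
  then show False using J by (simp add: A_def)
qed

text \<open>A frequency of largest modulus strictly dominates in the direction conjugate to it.\<close>

lemma exp_poly_eq_0_imp_coeff_0:
  assumes I: "finite I" and zero: "\<And>z. exp_poly I c z = 0" and i: "i \<in> I"
  shows "c i = 0"
proof (rule ccontr)
  assume ci: "c i \<noteq> 0"
  define A where "A = {i\<in>I. c i \<noteq> 0}"
  have A: "finite A" "i \<in> A" using I i ci by (auto simp: A_def)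
  define m where "m = Max ((\<lambda>i. norm (fst i)) ` A)"
  have "m \<in> (\<lambda>i. norm (fst i)) ` A" unfolding m_def using A by (intro Max_in) auto
  then obtain \<mu>0 j0 where \<mu>0: "(\<mu>0, j0) \<in> A" "norm \<mu>0 = m" by auto
  have m: "norm \<mu> \<le> m" if "(\<mu>, j) \<in> A" for \<mu> j
    unfolding m_def using that A by (intro Max_ge) force+
  define J where "J = Max {j. (\<mu>0, j) \<in> A}"
  have finJ: "finite {j. (\<mu>0, j) \<in> A}"
    by (rule finite_subset[OF _ finite_imageI[OF A(1), of snd]]) force
  have J: "(\<mu>0, J) \<in> A" using Max_in[OF finJ] \<mu>0 unfolding J_def by auto
  have J': "j \<le> J" if "(\<mu>0, j) \<in> A" for j
    unfolding J_def using that finJ by (intro Max_ge) auto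
  \<comment> \<open>If \<open>\<mu>0 = 0\<close>, all active frequencies are 0 and any direction
    serves; otherwise the choice makes \<open>\<omega> * \<mu>0\<close> equal to the modulus of
    \<open>\<mu>0\<close>.\<close>
  define \<omega> where "\<omega> = (if \<mu>0 = 0 then 1 else cnj \<mu>0 / of_real (norm \<mu>0))"
  have \<omega>: "norm \<omega> = 1" by (simp add: \<omega>_def norm_divide)
  define x where "x = (\<lambda>k. complex_of_real (real (Suc k)) * \<omega>)"
  have nx: "norm (x k) = real (Suc k)" for k by (simp only: x_def norm_mult \<omega> norm_of_real) simp
  have x: "filterlim x at_infinity sequentially"
    by (intro filterlim_norm_at_top_imp_at_infinity)
      (simp only: nx filterlim_compose[OF filterlim_real_sequentially filterlim_Suc])
  have "x k / complex_of_real (norm (x k)) = \<omega>" for k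
    unfolding nx by (simp only: x_def) (simp del: of_nat_Suc)
  then have dir: "(\<lambda>k. x k / complex_of_real (norm (x k))) \<longlonglongrightarrow> \<omega>" by simp
  have "(\<lambda>k. exp_poly I c (x k) / (x k ^ J * exp (\<mu>0 * x k))) \<longlonglongrightarrow> c (\<mu>0, J)"
  proof (rule exp_poly_leading_term[OF x dir I])
    show "(\<mu>0, J) \<in> I" using J by (simp add: A_def)
    fix \<mu> j assume *: "(\<mu>, j) \<in> I" "c (\<mu>, j) \<noteq> 0" "(\<mu>, j) \<noteq> (\<mu>0, J)"
    then have inA: "(\<mu>, j) \<in> A" by (simp add: A_def)
    show "Re (\<omega> * \<mu>) < Re (\<omega> * \<mu>0) \<or> \<mu> = \<mu>0 \<and> j < J"
    proof (cases "\<mu> = \<mu>0")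
      case True
      then show ?thesis using J' inA *(3) by force
    next
      case False
      then have nz: "\<mu>0 \<noteq> 0" using m[OF inA] \<mu>0(2) by auto
      have r0: "Re (\<omega> * \<mu>0) = m"
        using nz by (simp add: \<omega>_def \<mu>0(2)[symmetric] complex_norm_square[symmetric] power2_eq_square mult.commute[of "cnj \<mu>0"])
      \<comment> \<open>Equality of real part and modulus would force
        \<open>\<omega> * \<mu>\<close> to be the real number \<open>m\<close>, hence
        \<open>\<mu> = \<mu>0\<close>.\<close>
      have "Re (\<omega> * \<mu>) < m"
      proof (rule ccontr)
        assume "\<not> Re (\<omega> * \<mu>) < m"
        moreover have "Re (\<omega> * \<mu>) \<le> norm (\<omega> * \<mu>)" by (rule complex_Re_le_cmod)
        moreover have "norm (\<omega> * \<mu>) \<le> m" using m[OF inA] by (simp add: norm_mult \<omega>)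
        ultimately have "Re (\<omega> * \<mu>) = m" "norm (\<omega> * \<mu>) = m" by linarith+
        then have "\<omega> * \<mu> = of_real m"
          using cmod_power2[of "\<omega> * \<mu>"] by (intro complex_eqI) auto
        moreover have "\<omega> * \<mu>0 = of_real m"
          using nz by (simp add: \<omega>_def \<mu>0(2)[symmetric] complex_norm_square[symmetric] power2_eq_square mult.commute[of "cnj \<mu>0"])
        ultimately have "\<omega> * \<mu> = \<omega> * \<mu>0" by simp
        moreover have "\<omega> \<noteq> 0" using \<omega> by auto
        ultimately show False using False by simp
      qed
      then show ?thesis using r0 by simp
    qed
  qed
  then have "c (\<mu>0, J) = 0" by (simp add: zero LIMSEQ_const_iff)
  then show False using J by (simp add: A_def)
qed

section \<open>Convolution operators and lacunary products\<close>

lemma entire_higher_deriv: "entire f \<Longrightarrow> entire ((deriv ^^ j) f)"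
  unfolding entire_def by (intro holomorphic_higher_deriv) auto

lemma entire_deriv: "entire f \<Longrightarrow> entire (deriv f)"
  using entire_higher_deriv[of f 1] by simp

lemma entire_add: "entire f \<Longrightarrow> entire g \<Longrightarrow> entire (\<lambda>z. f z + g z)"
  and entire_diff: "entire f \<Longrightarrow> entire g \<Longrightarrow> entire (\<lambda>z. f z - g z)"
  and entire_mult: "entire f \<Longrightarrow> entire g \<Longrightarrow> entire (\<lambda>z. f z * g z)"
  and entire_cmult: "entire f \<Longrightarrow> entire (\<lambda>z. c * f z)"
  and entire_exp: "entire (\<lambda>z. exp (l * z))"
  and entire_const: "entire (\<lambda>z. c)"
  unfolding entire_def by (intro holomorphic_intros; assumption)+

lemma entire_sum: "(\<And>i. i \<in> I \<Longrightarrow> entire (f i)) \<Longrightarrow> entire (\<lambda>z. \<Sum>i\<in>I. f i z)"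
  unfolding entire_def by (intro holomorphic_intros)

lemma higher_deriv_entire_add:
  "entire f \<Longrightarrow> entire g \<Longrightarrow> (deriv ^^ j) (\<lambda>z. f z + g z) w = (deriv ^^ j) f w + (deriv ^^ j) g w"
  and higher_deriv_entire_diff:
  "entire f \<Longrightarrow> entire g \<Longrightarrow> (deriv ^^ j) (\<lambda>z. f z - g z) w = (deriv ^^ j) f w - (deriv ^^ j) g w"
  and higher_deriv_entire_cmult:
  "entire f \<Longrightarrow> (deriv ^^ j) (\<lambda>z. c * f z) w = c * (deriv ^^ j) f w"
  unfolding entire_def
  by (auto intro: higher_deriv_add higher_deriv_diff higher_deriv_cmult)

lemma higher_deriv_entire_sum:
  assumes "\<And>i. i \<in> I \<Longrightarrow> entire (f i)"
  shows "(deriv ^^ j) (\<lambda>z. \<Sum>i\<in>I. f i z) w = (\<Sum>i\<in>I. (deriv ^^ j) (f i) w)"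
  using assms
proof (induction I rule: infinite_finite_induct)
  case (insert i I)
  then show ?case by (simp add: higher_deriv_entire_add entire_sum)
qed auto

lemma higher_deriv_exp_mult: "(deriv ^^ j) (\<lambda>z. exp (l * z)) w = l ^ j * exp (l * w)"
proof (induction j arbitrary: w)
  case (Suc j)
  have "(deriv ^^ j) (\<lambda>z. exp (l * z)) = (\<lambda>w. l ^ j * exp (l * w))" using Suc by blast
  moreover have "((\<lambda>w. l ^ j * exp (l * w)) has_field_derivative l ^ j * (exp (l * w) * l)) (at w)"
    by (auto intro!: derivative_eq_intros)
  ultimately show ?case by (simp add: DERIV_imp_deriv mult_ac)
qed simp

lemma norm_higher_deriv_le:
  assumes "entire f" "\<And>w. dist z w \<le> 1 \<Longrightarrow> norm (f w) \<le> B"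
  shows "norm ((deriv ^^ n) f z) \<le> fact n * B"
proof -
  have "norm ((deriv ^^ n) f z) \<le> fact n * B / 1 ^ n"
    using assms unfolding entire_def
    by (intro Cauchy_inequality)
      (auto intro: holomorphic_on_subset holomorphic_on_imp_continuous_on simp: dist_norm)
  then show ?thesis by simp
qed

lemma entire_bounded_on_cball:
  assumes "entire f"
  obtains B where "B \<ge> 0" "\<And>w. norm w \<le> R \<Longrightarrow> norm (f w) \<le> B"
proof -
  have "compact (f ` cball 0 R)" using assms unfolding entire_def
    by (intro compact_continuous_image holomorphic_on_imp_continuous_on)
      (auto intro: holomorphic_on_subset)
  then obtain B where "\<forall>y\<in>f ` cball 0 R. norm y \<le> B"
    using compact_imp_bounded bounded_iff by blast
  then have "norm w \<le> R \<Longrightarrow> norm (f w) \<le> max B 0" for w by (auto simp: le_max_iff_disj)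
  with that[of "max B 0"] show thesis by simp
qed

text \<open>The series is controlled by convergence of the sum of
  \<open>norm (a j) * fact j\<close>: Cauchy's estimate on unit discs bounds the j-th derivative by
  \<open>fact j\<close> times a supremum. The Taylor coefficients of lacunary products satisfy this
  condition.\<close>

definition conv_op :: "(nat \<Rightarrow> complex) \<Rightarrow> (complex \<Rightarrow> complex) \<Rightarrow> complex \<Rightarrow> complex" where
  "conv_op a f z = (\<Sum>j. a j * (deriv ^^ j) f z)"

lemma norm_conv_op_term_le:
  assumes "entire f" "\<And>w. dist z w \<le> 1 \<Longrightarrow> norm (f w) \<le> B"
  shows "norm (a j * (deriv ^^ j) f z) \<le> norm (a j) * fact j * B"
proof -
  have "norm ((deriv ^^ j) f z) \<le> fact j * B" by (rule norm_higher_deriv_le[OF assms(1)]) (rule assms(2))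
  from mult_left_mono[OF this, of "norm (a j)"] show ?thesis by (simp add: norm_mult mult_ac)
qed

lemma conv_op_summable:
  assumes a: "summable (\<lambda>j. norm (a j) * fact j)" and f: "entire f"
  shows "summable (\<lambda>j. norm (a j * (deriv ^^ j) f z))" "summable (\<lambda>j. a j * (deriv ^^ j) f z)"
proof -
  obtain B where B: "\<And>w. norm w \<le> norm z + 1 \<Longrightarrow> norm (f w) \<le> B"
    using entire_bounded_on_cball[OF f] by metis
  have B': "norm (f w) \<le> B" if "dist z w \<le> 1" for w
    using that norm_triangle_ineq2[of w z] by (intro B) (simp add: dist_norm norm_minus_commute)
  show "summable (\<lambda>j. norm (a j * (deriv ^^ j) f z))"
    by (rule summable_comparison_test'[OF summable_mult2[OF a, of B], of 0])
      (use norm_conv_op_term_le[where z = z, OF f, of B] B' in simp)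
  then show "summable (\<lambda>j. a j * (deriv ^^ j) f z)" by (rule summable_norm_cancel)
qed

lemma norm_conv_op_le:
  assumes a: "summable (\<lambda>j. norm (a j) * fact j)" and f: "entire f"
    and B: "\<And>w. dist z w \<le> 1 \<Longrightarrow> norm (f w) \<le> B"
  shows "norm (conv_op a f z) \<le> (\<Sum>j. norm (a j) * fact j) * B"
proof -
  have "norm (conv_op a f z) \<le> (\<Sum>j. norm (a j * (deriv ^^ j) f z))"
    unfolding conv_op_def by (rule summable_norm[OF conv_op_summable(1)[OF a f]])
  also have "\<dots> \<le> (\<Sum>j. norm (a j) * fact j * B)"
    by (intro suminf_le conv_op_summable(1)[OF a f] summable_mult2[OF a] norm_conv_op_term_le f B)
  also have "\<dots> = (\<Sum>j. norm (a j) * fact j) * B" by (rule suminf_mult2[OF a, symmetric])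
  finally show ?thesis .
qed

lemma conv_op_add:
  assumes a: "summable (\<lambda>j. norm (a j) * fact j)" and "entire f" "entire g"
  shows "conv_op a (\<lambda>z. f z + g z) z = conv_op a f z + conv_op a g z"
  using conv_op_summable(2)[OF a] assms(2,3)
  by (simp add: conv_op_def higher_deriv_entire_add distrib_left suminf_add)

lemma conv_op_cmult:
  assumes a: "summable (\<lambda>j. norm (a j) * fact j)" and "entire f"
  shows "conv_op a (\<lambda>z. c * f z) z = c * conv_op a f z"
  using suminf_mult[OF conv_op_summable(2)[OF assms], of c] assms(2)
  by (simp add: conv_op_def higher_deriv_entire_cmult mult_ac)

lemma conv_op_diff:
  assumes a: "summable (\<lambda>j. norm (a j) * fact j)" and "entire f" "entire g"
  shows "conv_op a (\<lambda>z. f z - g z) z = conv_op a f z - conv_op a g z"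
  using conv_op_summable(2)[OF a] assms(2,3)
  by (simp add: conv_op_def higher_deriv_entire_diff right_diff_distrib suminf_diff)

lemma conv_op_sum:
  assumes a: "summable (\<lambda>j. norm (a j) * fact j)" and "\<And>i. i \<in> I \<Longrightarrow> entire (f i)"
  shows "conv_op a (\<lambda>z. \<Sum>i\<in>I. f i z) z = (\<Sum>i\<in>I. conv_op a (f i) z)"
  using assms(2)
proof (induction I rule: infinite_finite_induct)
  case (insert i I)
  then show ?case by (simp add: conv_op_add[OF a] entire_sum)
qed (use conv_op_cmult[OF a entire_const, of 0] in auto)

lemma conv_op_exp:
  assumes "\<And>z. (\<lambda>j. a j * z ^ j) sums G z"
  shows "conv_op a (\<lambda>z. exp (l * z)) z = G l * exp (l * z)"
proof -
  have "(\<lambda>j. a j * l ^ j * exp (l * z)) sums (G l * exp (l * z))"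
    by (intro sums_mult2 assms)
  then show ?thesis by (simp add: conv_op_def higher_deriv_exp_mult mult.assoc sums_iff)
qed

lemma has_field_derivative_conv_op:
  assumes a: "summable (\<lambda>j. norm (a j) * fact j)" and f: "entire f"
  shows "(conv_op a f has_field_derivative conv_op a (deriv f) z) (at z)"
proof -
  define R where "R = norm z + 1"
  obtain B where B: "\<And>w. norm w \<le> R + 1 \<Longrightarrow> norm (deriv f w) \<le> B"
    using entire_bounded_on_cball[OF entire_deriv[OF f]] by metis
  have "((\<lambda>z. \<Sum>j. a j * (deriv ^^ j) f z) has_field_derivative (\<Sum>j. a j * (deriv ^^ j) (deriv f) z)) (at z)"
  proof (rule has_field_derivative_series'(2)[of "ball 0 R" _ _ 0])
    fix n x
    have "((deriv ^^ n) f has_field_derivative (deriv ^^ n) (deriv f) x) (at x)"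
      using has_field_derivative_higher_deriv[of f UNIV x n] f
      by (simp add: entire_def funpow_swap1)
    then show "((\<lambda>z. a n * (deriv ^^ n) f z) has_field_derivative a n * (deriv ^^ n) (deriv f) x)
        (at x within ball 0 R)"
      by (intro DERIV_cmult) (rule has_field_derivative_at_within)
  next
    show "uniformly_convergent_on (ball 0 R) (\<lambda>n x. \<Sum>i<n. a i * (deriv ^^ i) (deriv f) x)"
    proof (rule Weierstrass_m_test')
      show "summable (\<lambda>n. norm (a n) * fact n * B)" by (rule summable_mult2[OF a])
      fix n x assume x: "x \<in> ball (0::complex) R"
      have nw: "norm w \<le> R + 1" if "dist x w \<le> 1" for w
        using norm_triangle_sub[of w x] that x by (simp add: dist_norm norm_minus_commute)
      show "norm (a n * (deriv ^^ n) (deriv f) x) \<le> norm (a n) * fact n * B"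
        by (intro norm_conv_op_term_le entire_deriv f B nw)
    qed
  qed (use conv_op_summable(2)[OF a f] in \<open>auto simp: R_def add_nonneg_pos\<close>)
  then show ?thesis by (simp add: conv_op_def[abs_def])
qed

lemma entire_conv_op:
  "summable (\<lambda>j. norm (a j) * fact j) \<Longrightarrow> entire f \<Longrightarrow> entire (conv_op a f)"
  unfolding entire_def[of "conv_op a f"] using has_field_derivative_conv_op
  by (metis holomorphic_on_open open_UNIV)

lemma higher_deriv_conv_op:
  assumes a: "summable (\<lambda>j. norm (a j) * fact j)" and "entire f"
  shows "(deriv ^^ k) (conv_op a f) = conv_op a ((deriv ^^ k) f)"
  using assms(2)
proof (induction k arbitrary: f)
  case (Suc k)
  have "deriv (conv_op a f) = conv_op a (deriv f)"
    using has_field_derivative_conv_op[OF a Suc.prems] DERIV_imp_deriv by blast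
  then show ?case
    using Suc.IH[OF entire_deriv[OF Suc.prems]] by (simp add: funpow_Suc_right del: funpow.simps)
qed simp

lemma conv_op_tendsto:
  assumes a: "summable (\<lambda>j. norm (a j) * fact j)"
    and f: "\<And>n. entire (f n)" and g: "entire g"
    and lim: "\<And>K. compact K \<Longrightarrow> uniform_limit K f g sequentially"
  shows "(\<lambda>n. conv_op a (f n) z) \<longlonglongrightarrow> conv_op a g z"
proof (rule tendstoI)
  fix e :: real assume e: "e > 0"
  define S where "S = (\<Sum>j. norm (a j) * fact j)"
  have S: "S \<ge> 0" unfolding S_def by (intro suminf_nonneg a) auto
  have "eventually (\<lambda>n. \<forall>w\<in>cball z 1. dist (f n w) (g w) < e / (S + 1)) sequentially"
    using lim[of "cball z 1"] e S by (auto simp: uniform_limit_iff)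
  then show "eventually (\<lambda>n. dist (conv_op a (f n) z) (conv_op a g z) < e) sequentially"
  proof eventually_elim
    case (elim n)
    have "norm (conv_op a (\<lambda>w. f n w - g w) z) \<le> S * (e / (S + 1))"
      unfolding S_def
      by (rule norm_conv_op_le[OF a entire_diff[OF f g]])
        (use elim in \<open>auto simp: dist_norm S_def intro: less_imp_le\<close>)
    also have "\<dots> < e" using S e by (simp add: field_simps)
    finally show ?case by (simp add: dist_norm conv_op_diff[OF a f g])
  qed
qed

section \<open>Taylor coefficients of lacunary products\<close>

lemma taylor_coeff_mult_linear:
  assumes "entire g"
  shows "taylor_coeff (\<lambda>z. (1 - z / l) * g z) (Suc j) = taylor_coeff g (Suc j) - taylor_coeff g j / l"
    "taylor_coeff (\<lambda>z. (1 - z / l) * g z) 0 = taylor_coeff g 0"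
proof -
  have h: "(deriv ^^ n) (\<lambda>z. 1 - z / l) 0 = (if n = 0 then 1 else if n = 1 then - 1 / l else 0)" for n
  proof -
    have 1: "deriv (\<lambda>z. 1 - z / l) = (\<lambda>z. - 1 / l)"
    proof
      fix z
      have "((\<lambda>z. 1 - z / l) has_field_derivative (- 1 / l)) (at z)"
        by (cases "l = 0") (auto intro!: derivative_eq_intros)
      then show "deriv (\<lambda>z. 1 - z / l) z = - 1 / l" by (rule DERIV_imp_deriv)
    qed
    show ?thesis
    proof (cases n)
      case (Suc k)
      then show ?thesis by (cases k) (simp_all add: funpow_Suc_right 1 del: funpow.simps)
    qed simp
  qed
  have hol: "(\<lambda>z. 1 - z / l) holomorphic_on UNIV"
    by (cases "l = 0") (auto intro!: holomorphic_intros)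
  have "(deriv ^^ Suc j) (\<lambda>z. (1 - z / l) * g z) 0 =
    (\<Sum>i = 0..Suc j. of_nat (Suc j choose i) * (deriv ^^ i) (\<lambda>z. 1 - z / l) 0 * (deriv ^^ (Suc j - i)) g 0)"
    using hol assms unfolding entire_def by (intro higher_deriv_mult) auto
  \<comment> \<open>In Leibniz' formula only the derivatives of order 0 and 1 of the linear factor
    survive.\<close>
  also have "\<dots> = (\<Sum>i\<in>{0, 1}. of_nat (Suc j choose i) * (deriv ^^ i) (\<lambda>z. 1 - z / l) 0 * (deriv ^^ (Suc j - i)) g 0)"
    by (rule sum.mono_neutral_right) (auto simp: h simp del: funpow.simps)
  also have "\<dots> = (deriv ^^ Suc j) g 0 - of_nat (Suc j) * (deriv ^^ j) g 0 / l"
    by (simp add: h del: funpow.simps)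
  finally have *: "(deriv ^^ Suc j) (\<lambda>z. (1 - z / l) * g z) 0 =
    (deriv ^^ Suc j) g 0 - of_nat (Suc j) * (deriv ^^ j) g 0 / l" .
  show "taylor_coeff (\<lambda>z. (1 - z / l) * g z) (Suc j) = taylor_coeff g (Suc j) - taylor_coeff g j / l"
    unfolding taylor_coeff_def * fact_Suc of_nat_mult diff_divide_distrib
    by (simp del: of_nat_Suc funpow.simps)
  show "taylor_coeff (\<lambda>z. (1 - z / l) * g z) 0 = taylor_coeff g 0"
    by (simp add: taylor_coeff_def)
qed

lemma taylor_coeff_sums: "entire g \<Longrightarrow> (\<lambda>j. taylor_coeff g j * z ^ j) sums g z"
  using holomorphic_power_series[of g 0 "norm z + 1" z]
  by (auto simp: entire_def taylor_coeff_def intro: holomorphic_on_subset)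

text \<open>Majorant of the Taylor coefficients of \<open>\<Prod>n. 1 - z / l\<^sub>n\<close> with \<open>\<bar>l\<^sub>n\<bar> \<ge> 2 ^ n\<close>: the recursion
  is \<open>B\<^sub>j = 2\<^sup>-\<^sup>j (B\<^sub>j + 2 B\<^sub>j\<^sub>-\<^sub>1)\<close>, which splitting off the first factor reproduces.\<close>

fun maj :: "nat \<Rightarrow> real" where
  "maj 0 = 1" | "maj (Suc j) = 2 * maj j / (2 ^ Suc j - 1)"

lemma maj_pos: "maj j > 0"
proof (induction j)
  case (Suc j)
  have "(2::real) ^ Suc j > 1" by (rule one_less_power) auto
  then show ?case using Suc by simp
qed simp

lemma maj_rec: "(maj (Suc j) + 2 * maj j) / 2 ^ Suc j = maj (Suc j)"
proof -
  have "(2::real) ^ Suc j > 1" by (rule one_less_power) auto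
  then show ?thesis by (simp add: field_simps)
qed

text \<open>Consecutive terms have a quotient of order n / 2 ^ n, so the decay of \<open>maj\<close>
  beats the factorial of Cauchy's estimate and any geometric factor.\<close>

lemma summable_maj_fact:
  assumes "R > 0"
  shows "summable (\<lambda>j. maj j * fact j * R ^ j)"
proof -
  have "(\<lambda>n. 2 * (real n + 1) * R / (2 ^ Suc n - 1)) \<longlonglongrightarrow> 0"
    by real_asymp
  then have "eventually (\<lambda>n. 2 * (real n + 1) * R / (2 ^ Suc n - 1) < 1 / 2) sequentially"
    by (rule order_tendstoD) auto
  then obtain N where N: "\<And>n. n \<ge> N \<Longrightarrow> 2 * (real n + 1) * R / (2 ^ Suc n - 1) < 1 / 2"
    by (auto simp: eventually_sequentially)
  show ?thesis
  proof (rule summable_ratio_test[of "1 / 2" N])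
    fix n assume "n \<ge> N"
    have "maj (Suc n) * fact (Suc n) * R ^ Suc n
       = 2 * (real n + 1) * R / (2 ^ Suc n - 1) * (maj n * fact n * R ^ n)"
      by (simp add: algebra_simps)
    also have "\<dots> \<le> 1 / 2 * (maj n * fact n * R ^ n)"
      using N[OF \<open>n \<ge> N\<close>] maj_pos[of n] assms by (intro mult_right_mono) auto
    finally show "norm (maj (Suc n) * fact (Suc n) * R ^ Suc n) \<le> 1 / 2 * norm (maj n * fact n * R ^ n)"
      using maj_pos[of n] maj_pos[of "Suc n"] assms by (simp add: abs_mult del: maj.simps)
  qed auto
qed

locale lacunary_seq =
  fixes lam :: "nat \<Rightarrow> complex"
  assumes nz: "lam n \<noteq> 0" and lac: "norm (lam (Suc n)) > 2 * norm (lam n)"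
begin

text \<open>Makes every fact of the locale available for the products without their first
  \<open>N\<close> factors.\<close>

lemma shift: "lacunary_seq (\<lambda>n. lam (n + N))"
  by unfold_locales (use nz lac in auto)

lemma norm_ge: "norm (lam n) \<ge> 2 ^ n * norm (lam 0)"
proof (induction n)
  case (Suc n)
  then show ?case using lac[of n] by simp
qed simp

lemma norm_strict_mono: "strict_mono (\<lambda>n. norm (lam n))"
proof (rule strict_monoI_Suc)
  fix n show "norm (lam n) < norm (lam (Suc n))" using lac[of n] norm_ge_zero[of "lam n"] by linarith
qed

lemma inj: "inj lam"
  using strict_mono_eq[OF norm_strict_mono] by (metis injI)

definition partial :: "nat \<Rightarrow> complex \<Rightarrow> complex" where
  "partial N z = (\<Prod>n<N. 1 - z / lam n)"

lemma norm_quotient_le: "norm (z / lam n) \<le> norm z / norm (lam 0) * (1 / 2) ^ n"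
proof -
  have "norm (z / lam n) \<le> norm z / (2 ^ n * norm (lam 0))"
    unfolding norm_divide by (rule divide_left_mono[OF norm_ge]) (use nz in auto)
  then show ?thesis by (simp add: power_one_over mult.commute)
qed

lemma convergent_prod: "convergent_prod (\<lambda>n. 1 - z / lam n)"
proof (rule abs_convergent_prod_imp_convergent_prod, rule summable_imp_abs_convergent_prod)
  show "summable (\<lambda>i. norm (1 - z / lam i - 1))"
    by (rule summable_comparison_test'[of "\<lambda>n. norm z / norm (lam 0) * (1 / 2) ^ n" 0])
      (use norm_quotient_le[of z] in \<open>auto intro!: summable_mult\<close>)
qed

lemma partial_uniform_limit:
  assumes K: "compact K"
  shows "uniform_limit K partial (G1 lam) sequentially"
proof -
  obtain B where B: "\<And>z. z \<in> K \<Longrightarrow> norm z \<le> B"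
    using compact_imp_bounded[OF K] bounded_iff by blast
  have "uniformly_convergent_on K (\<lambda>N z. \<Prod>n<N. 1 - z / lam n)"
  proof (rule uniformly_convergent_on_prod'[OF _ K])
    show "uniformly_convergent_on K (\<lambda>N x. \<Sum>n<N. norm (1 - x / lam n - 1))"
    proof (rule Weierstrass_m_test')
      show "summable (\<lambda>n. B / norm (lam 0) * (1 / 2) ^ n)" by (auto intro!: summable_mult)
      fix n z assume "z \<in> K"
      have "norm (z / lam n) \<le> norm z / norm (lam 0) * (1 / 2) ^ n" by (rule norm_quotient_le)
      also have "\<dots> \<le> B / norm (lam 0) * (1 / 2) ^ n"
        using B[OF \<open>z \<in> K\<close>] by (intro mult_right_mono divide_right_mono) auto
      finally show "norm (norm (1 - z / lam n - 1)) \<le> B / norm (lam 0) * (1 / 2) ^ n" by simp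
    qed
  qed (use nz in \<open>auto intro!: continuous_intros\<close>)
  then obtain g where g: "uniform_limit K partial g sequentially"
    by (auto simp: uniformly_convergent_on_def partial_def[abs_def])
  have "g z = G1 lam z" if "z \<in> K" for z
  proof -
    have "(\<lambda>N. \<Prod>n\<le>N. 1 - z / lam n) \<longlonglongrightarrow> G1 lam z"
      unfolding G1_def by (rule convergent_prod_LIMSEQ[OF convergent_prod])
    moreover have "(\<lambda>N. partial (Suc N) z) \<longlonglongrightarrow> g z"
      using tendsto_uniform_limitI[OF g that] LIMSEQ_Suc by blast
    ultimately show ?thesis
      using LIMSEQ_unique by (auto simp: partial_def lessThan_Suc_atMost)
  qed
  then show ?thesis using g uniform_limit_cong' by (metis (no_types, lifting))
qed

lemma entire_partial: "entire (partial N)"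
  unfolding entire_def partial_def[abs_def] by (intro holomorphic_intros) (use nz in auto)

lemma entire_G1: "entire (G1 lam)"
  unfolding entire_def
proof (rule holomorphic_uniform_sequence[of UNIV partial])
  fix z :: complex
  show "\<exists>d>0. cball z d \<subseteq> UNIV \<and> uniform_limit (cball z d) partial (G1 lam) sequentially"
    using partial_uniform_limit[OF compact_cball, of z 1] by (intro exI[of _ 1]) auto
qed (use entire_partial in \<open>auto simp: entire_def\<close>)

lemma taylor_coeff_partial_tendsto:
  "(\<lambda>N. taylor_coeff (partial N) j) \<longlonglongrightarrow> taylor_coeff (G1 lam) j"
  unfolding taylor_coeff_def
proof (intro tendsto_divide tendsto_const)
  show "(\<lambda>N. (deriv ^^ j) (partial N) 0) \<longlonglongrightarrow> (deriv ^^ j) (G1 lam) 0"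
  proof (rule higher_deriv_complex_uniform_limit)
    show "uniform_limit (ball 0 1) partial (G1 lam) sequentially"
      using partial_uniform_limit[OF compact_cball] ball_subset_cball uniform_limit_on_subset by blast
  qed (use entire_partial in \<open>auto simp: entire_def intro: always_eventually holomorphic_on_subset\<close>)
qed auto

text \<open>Convergence of the product in the strict sense allows a zero only through a vanishing
  factor.\<close>

lemma G1_nonzero: "z \<notin> range lam \<Longrightarrow> G1 lam z \<noteq> 0"
  unfolding G1_def
  by (rule prodinf_nonzero[OF convergent_prod]) (use nz in \<open>auto simp: divide_eq_eq\<close>)

lemma G1_zero: "G1 lam (lam n) = 0"
proof (rule LIMSEQ_unique)
  show "(\<lambda>N. partial N (lam n)) \<longlonglongrightarrow> G1 lam (lam n)"
    using tendsto_uniform_limitI[OF partial_uniform_limit[of "{lam n}"]] by auto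
  have "eventually (\<lambda>N. partial N (lam n) = 0) sequentially"
    using eventually_gt_at_top[of n] by eventually_elim (use nz in \<open>auto simp: partial_def\<close>)
  then show "(\<lambda>N. partial N (lam n)) \<longlonglongrightarrow> 0" by (rule tendsto_eventually)
qed

lemma partial_shift: "partial (Suc N) z = (1 - z / lam 0) * lacunary_seq.partial (\<lambda>n. lam (n + 1)) N z"
proof -
  interpret s: lacunary_seq "\<lambda>n. lam (n + 1)" by (rule shift)
  show ?thesis unfolding partial_def s.partial_def by (subst prod.lessThan_Suc_shift) simp
qed

lemma G1_shift: "G1 lam z = (1 - z / lam 0) * G1 (\<lambda>n. lam (n + 1)) z"
proof (rule LIMSEQ_unique)
  interpret s: lacunary_seq "\<lambda>n. lam (n + 1)" by (rule shift)
  show "(\<lambda>N. partial (Suc N) z) \<longlonglongrightarrow> G1 lam z"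
    using tendsto_uniform_limitI[OF partial_uniform_limit[of "{z}"]] by (auto intro: LIMSEQ_Suc)
  show "(\<lambda>N. partial (Suc N) z) \<longlonglongrightarrow> (1 - z / lam 0) * G1 (\<lambda>n. lam (n + 1)) z"
    unfolding partial_shift using tendsto_uniform_limitI[OF s.partial_uniform_limit[of "{z}"]]
    by (auto intro!: tendsto_intros)
qed

lemma taylor_coeff_G1_shift:
  "taylor_coeff (G1 lam) (Suc j) =
     taylor_coeff (G1 (\<lambda>n. lam (n + 1))) (Suc j) - taylor_coeff (G1 (\<lambda>n. lam (n + 1))) j / lam 0"
  "taylor_coeff (G1 lam) 0 = 1"
proof -
  interpret s: lacunary_seq "\<lambda>n. lam (n + 1)" by (rule shift)
  show "taylor_coeff (G1 lam) (Suc j) =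
     taylor_coeff (G1 (\<lambda>n. lam (n + 1))) (Suc j) - taylor_coeff (G1 (\<lambda>n. lam (n + 1))) j / lam 0"
    using taylor_coeff_mult_linear(1)[OF s.entire_G1, of "lam 0" j] by (simp add: G1_shift[abs_def])
  show "taylor_coeff (G1 lam) 0 = 1" by (simp add: taylor_coeff_def G1_def)
qed

end

text \<open>The induction on the number of factors runs over all lacunary sequences at once, because
  splitting off the first factor leaves the partial product of the shifted sequence, whose first
  term is at least twice as large.\<close>

lemma norm_taylor_coeff_partial_le:
  assumes "lacunary_seq lam"
  shows "norm (taylor_coeff (lacunary_seq.partial lam N) j) \<le> maj j / norm (lam 0) ^ j"
  using assms
proof (induction N arbitrary: lam j)
  case 0
  then interpret lacunary_seq lam .
  have "(deriv ^^ j) (\<lambda>z. 1) 0 = (if j = 0 then 1 else 0 :: complex)"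
    by (cases j) (simp_all add: funpow_Suc_right del: funpow.simps)
  then show ?case using maj_pos[of j]
    by (auto simp: taylor_coeff_def partial_def[abs_def] intro!: divide_nonneg_nonneg less_imp_le)
next
  case (Suc N)
  interpret lacunary_seq lam by fact
  interpret s: lacunary_seq "\<lambda>n. lam (n + 1)" by (rule shift)
  note IH = Suc.IH[OF s.lacunary_seq_axioms]
  have eq: "partial (Suc N) = (\<lambda>z. (1 - z / lam 0) * s.partial N z)"
    by (rule ext) (rule partial_shift)
  have l: "norm (lam 0) > 0" "norm (lam 1) \<ge> 2 * norm (lam 0)" using nz lac[of 0] by auto
  show ?case
  proof (cases j)
    case 0
    show ?thesis
      unfolding 0 eq taylor_coeff_mult_linear(2)[OF s.entire_partial] using IH[of 0] by simp
  next
    case (Suc i)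
    have "norm (taylor_coeff (partial (Suc N)) (Suc i)) \<le>
       norm (taylor_coeff (s.partial N) (Suc i)) + norm (taylor_coeff (s.partial N) i / lam 0)"
      unfolding eq taylor_coeff_mult_linear(1)[OF s.entire_partial] by (rule norm_triangle_ineq4)
    also have "\<dots> \<le> maj (Suc i) / norm (lam 1) ^ Suc i + maj i / norm (lam 1) ^ i / norm (lam 0)"
    proof (rule add_mono)
      show "norm (taylor_coeff (s.partial N) (Suc i)) \<le> maj (Suc i) / norm (lam 1) ^ Suc i"
        using IH[of "Suc i"] by (simp del: maj.simps)
      show "norm (taylor_coeff (s.partial N) i / lam 0) \<le> maj i / norm (lam 1) ^ i / norm (lam 0)"
        using divide_right_mono[OF IH[of i], of "norm (lam 0)"] by (simp add: norm_divide)
    qed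
    \<comment> \<open>Doubling from \<open>lam 0\<close> to \<open>lam 1\<close> supplies the powers
      of 2 with which \<open>maj_rec\<close> closes the induction.\<close>
    also have "\<dots> \<le> maj (Suc i) / (2 * norm (lam 0)) ^ Suc i + maj i / (2 * norm (lam 0)) ^ i / norm (lam 0)"
      using l maj_pos[of i] maj_pos[of "Suc i"]
      by (intro add_mono divide_right_mono divide_left_mono power_mono mult_pos_pos zero_less_power)
        (auto simp del: maj.simps)
    also have "\<dots> = ((maj (Suc i) + 2 * maj i) / 2 ^ Suc i) / norm (lam 0) ^ Suc i"
      using l by (simp add: field_simps power_mult_distrib del: maj.simps)
    also have "\<dots> = maj (Suc i) / norm (lam 0) ^ Suc i" unfolding maj_rec ..
    finally show ?thesis using Suc by simp
  qed
qed

context lacunary_seq begin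

lemma norm_taylor_coeff_G1_le: "norm (taylor_coeff (G1 lam) j) \<le> maj j / norm (lam 0) ^ j"
  by (rule LIMSEQ_le_const2[OF tendsto_norm[OF taylor_coeff_partial_tendsto]])
    (use norm_taylor_coeff_partial_le[OF lacunary_seq_axioms] in auto)

lemma summable_taylor_coeff_G1: "summable (\<lambda>j. norm (taylor_coeff (G1 lam) j) * fact j)"
proof (rule summable_comparison_test'[OF summable_maj_fact[of "1 / norm (lam 0)"], of 0])
  show "0 < 1 / norm (lam 0)" using nz by simp
  fix j
  have "norm (taylor_coeff (G1 lam) j) * fact j \<le> maj j / norm (lam 0) ^ j * fact j"
    by (intro mult_right_mono norm_taylor_coeff_G1_le) auto
  then show "norm (norm (taylor_coeff (G1 lam) j) * fact j) \<le> maj j * fact j * (1 / norm (lam 0)) ^ j"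
    by (simp add: power_one_over field_simps)
qed

section \<open>Tails of the product and spectral synthesis\<close>

definition tail_op :: "nat \<Rightarrow> (complex \<Rightarrow> complex) \<Rightarrow> complex \<Rightarrow> complex" where
  "tail_op N = conv_op (taylor_coeff (G1 (\<lambda>n. lam (n + N))))"

lemma conv_ker_iff: "f \<in> conv_ker (G1 lam) \<longleftrightarrow> entire f \<and> (\<forall>z. tail_op 0 f z = 0)"
  using conv_op_summable(2)[OF summable_taylor_coeff_G1, of f]
  by (auto simp: conv_ker_def Hspace_def tail_op_def conv_op_def sums_iff)

lemma conv_ker_tail_iff:
  "f \<in> conv_ker (G1 (\<lambda>n. lam (n + N))) \<longleftrightarrow> entire f \<and> (\<forall>z. tail_op N f z = 0)"
  using lacunary_seq.conv_ker_iff[OF shift, of f N] by (simp add: tail_op_def lacunary_seq.tail_op_def[OF shift])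

lemma summable_tail: "summable (\<lambda>j. norm (taylor_coeff (G1 (\<lambda>n. lam (n + N))) j) * fact j)"
  by (rule lacunary_seq.summable_taylor_coeff_G1[OF shift])

lemma entire_tail_op: "entire f \<Longrightarrow> entire (tail_op N f)"
  unfolding tail_op_def by (rule entire_conv_op[OF summable_tail])

lemma tail_op_exp: "tail_op N (\<lambda>z. exp (l * z)) z = G1 (\<lambda>n. lam (n + N)) l * exp (l * z)"
  unfolding tail_op_def
  by (rule conv_op_exp[OF taylor_coeff_sums[OF lacunary_seq.entire_G1[OF shift]]])

text \<open>Operator form of splitting the first linear factor off a tail: multiplication of the
  symbol by its variable corresponds to differentiation.\<close>

lemma tail_op_Suc:
  assumes f: "entire f"
  shows "tail_op N f z = tail_op (Suc N) f z - deriv (tail_op (Suc N) f) z / lam N"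
proof -
  interpret s: lacunary_seq "\<lambda>n. lam (n + N)" by (rule shift)
  let ?b = "taylor_coeff (G1 (\<lambda>n. lam (n + Suc N)))"
  have sh: "taylor_coeff (G1 (\<lambda>n. lam (n + N))) (Suc j) = ?b (Suc j) - ?b j / lam N" for j
    using s.taylor_coeff_G1_shift(1)[of j] by simp
  have b0: "taylor_coeff (G1 (\<lambda>n. lam (n + N))) 0 = ?b 0"
    using s.taylor_coeff_G1_shift(2) lacunary_seq.taylor_coeff_G1_shift(2)[OF shift] by metis
  have s1: "summable (\<lambda>j. ?b j * (deriv ^^ j) f z)"
    by (rule conv_op_summable(2)[OF summable_tail f])
  have s2: "summable (\<lambda>j. ?b j * (deriv ^^ j) (deriv f) z)"
    by (rule conv_op_summable(2)[OF summable_tail entire_deriv[OF f]])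
  have "tail_op N f z = ?b 0 * f z + (\<Sum>j. taylor_coeff (G1 (\<lambda>n. lam (n + N))) (Suc j) * (deriv ^^ Suc j) f z)"
    unfolding tail_op_def conv_op_def
    using suminf_split_head[OF conv_op_summable(2)[OF summable_tail[of N] f, of z]] b0 by simp
  also have "(\<Sum>j. taylor_coeff (G1 (\<lambda>n. lam (n + N))) (Suc j) * (deriv ^^ Suc j) f z)
    = (\<Sum>j. ?b (Suc j) * (deriv ^^ Suc j) f z - ?b j * (deriv ^^ j) (deriv f) z / lam N)"
    by (simp add: sh left_diff_distrib funpow_swap1)
  also have "\<dots> = (\<Sum>j. ?b (Suc j) * (deriv ^^ Suc j) f z) - (\<Sum>j. ?b j * (deriv ^^ j) (deriv f) z) / lam N"
    unfolding suminf_divide[OF s2, symmetric]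
    by (rule suminf_diff[symmetric, OF _ summable_divide[OF s2]])
      (use summable_ignore_initial_segment[OF s1, of 1] in \<open>simp del: funpow.simps\<close>)
  also have "?b 0 * f z + \<dots> = conv_op ?b f z - conv_op ?b (deriv f) z / lam N"
    using suminf_split_head[OF s1] by (simp add: conv_op_def)
  also have "conv_op ?b (deriv f) z = deriv (conv_op ?b f) z"
    using higher_deriv_conv_op[OF summable_tail f, of 1 "Suc N"] by simp
  finally show ?thesis by (simp add: tail_op_def)
qed

text \<open>A tail divides the full product, so its operator is a factor of the full one; the
  missing factors are restored one at a time.\<close>

lemma conv_ker_tail_subset: "conv_ker (G1 (\<lambda>n. lam (n + N))) \<subseteq> conv_ker (G1 lam)"
proof
  fix f assume f: "f \<in> conv_ker (G1 (\<lambda>n. lam (n + N)))"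
  then have e: "entire f" and 0: "tail_op N f = (\<lambda>z. 0)" by (auto simp: conv_ker_tail_iff)
  \<comment> \<open>Descending induction on the index; truncated subtraction keeps it at 0 once
    \<open>k\<close> passes \<open>N\<close>.\<close>
  have "tail_op (N - k) f = (\<lambda>z. 0)" for k
  proof (induction k)
    case (Suc k)
    show ?case
    proof (cases "k < N")
      case True
      then have "N - k = Suc (N - Suc k)" by simp
      with Suc have "tail_op (Suc (N - Suc k)) f = (\<lambda>z. 0)" by simp
      then show ?thesis using tail_op_Suc[OF e, of "N - Suc k"] by auto
    next
      case False
      then show ?thesis using Suc by simp
    qed
  qed (simp add: 0)
  from this[of N] show "f \<in> conv_ker (G1 lam)" using e by (simp add: conv_ker_iff)
qed

text \<open>The constant coefficient of every tail is 1, and each other coefficient carries at least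
  one factor \<open>1 / norm (lam N)\<close>, which decays like 2 ^ (-N).\<close>

lemma tail_op_tendsto:
  assumes f: "entire f"
  shows "(\<lambda>N. tail_op N f z) \<longlonglongrightarrow> f z"
proof -
  obtain B where B0: "B \<ge> 0" and B: "\<And>w. norm w \<le> norm z + 1 \<Longrightarrow> norm (f w) \<le> B"
    using entire_bounded_on_cball[OF f] by metis
  have B': "norm (f w) \<le> B" if "dist z w \<le> 1" for w
    using that norm_triangle_ineq2[of w z] by (intro B) (simp add: dist_norm norm_minus_commute)
  define c where "c = norm (lam 0)"
  have c: "c > 0" using nz by (simp add: c_def)
  define S where "S = (\<Sum>j. maj j * fact j * (1 / c) ^ j)"
  have sm: "summable (\<lambda>j. maj j * fact j * (1 / c) ^ j)"
    by (rule summable_maj_fact) (use c in simp)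
  have bound: "norm (tail_op N f z - f z) \<le> S * B * (1 / 2) ^ N" for N
  proof -
    let ?t = "taylor_coeff (G1 (\<lambda>n. lam (n + N)))"
    have t0: "?t 0 = 1" by (rule lacunary_seq.taylor_coeff_G1_shift(2)[OF shift])
    have st: "summable (\<lambda>j. norm (?t j * (deriv ^^ j) f z))"
      by (rule conv_op_summable(1)[OF summable_tail f])
    have "tail_op N f z = f z + (\<Sum>j. ?t (Suc j) * (deriv ^^ Suc j) f z)"
      unfolding tail_op_def conv_op_def
      using suminf_split_head[OF summable_norm_cancel[OF st]] t0 by simp
    then have "norm (tail_op N f z - f z) = norm (\<Sum>j. ?t (Suc j) * (deriv ^^ Suc j) f z)" by simp
    also have "\<dots> \<le> (\<Sum>j. norm (?t (Suc j) * (deriv ^^ Suc j) f z))"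
      using st by (intro summable_norm) (simp add: summable_Suc_iff[where f = "\<lambda>j. norm (?t j * (deriv ^^ j) f z)"] del: funpow.simps)
    also have "\<dots> \<le> (\<Sum>j. maj (Suc j) * fact (Suc j) * (1 / c) ^ Suc j * (B * (1 / 2) ^ N))"
    proof (rule suminf_le)
      fix j
      have "norm (?t (Suc j) * (deriv ^^ Suc j) f z) \<le> norm (?t (Suc j)) * fact (Suc j) * B"
        by (rule norm_conv_op_term_le[OF f]) (rule B')
      also have "norm (?t (Suc j)) \<le> maj (Suc j) / norm (lam N) ^ Suc j"
        using lacunary_seq.norm_taylor_coeff_G1_le[OF shift, of N "Suc j"] by simp
      also have "\<dots> \<le> maj (Suc j) / (2 ^ N * c ^ Suc j)"
      proof (rule divide_left_mono)
        \<comment> \<open>As the exponent is positive, one factor \<open>2 ^ N\<close> is kept and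
          the others are dropped; it provides the decay in \<open>N\<close>, uniformly in
          \<open>j\<close>.\<close>
        have "2 ^ N * c ^ Suc j \<le> (2 ^ N) ^ Suc j * c ^ Suc j"
          using c by (intro mult_right_mono self_le_power) auto
        also have "\<dots> = (2 ^ N * c) ^ Suc j" by (simp only: power_mult_distrib)
        also have "\<dots> \<le> norm (lam N) ^ Suc j"
          using norm_ge[of N] c by (intro power_mono) (auto simp: c_def)
        finally show "2 ^ N * c ^ Suc j \<le> norm (lam N) ^ Suc j" .
      qed (use maj_pos[of "Suc j"] c nz in \<open>auto simp del: maj.simps\<close>)
      also have "maj (Suc j) / (2 ^ N * c ^ Suc j) * fact (Suc j) * B
        = maj (Suc j) * fact (Suc j) * (1 / c) ^ Suc j * (B * (1 / 2) ^ N)"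
      proof -
        have "m / (p * q) * r * s = m * r * (1 / q) * (s * (1 / p))" for m p q r s :: real
          by (simp add: divide_inverse mult_ac)
        then show ?thesis unfolding power_one_over .
      qed
      finally show "norm (?t (Suc j) * (deriv ^^ Suc j) f z)
         \<le> maj (Suc j) * fact (Suc j) * (1 / c) ^ Suc j * (B * (1 / 2) ^ N)"
        using B0 by (simp add: mult_right_mono del: maj.simps funpow.simps fact_Suc power_Suc)
    next
      show "summable (\<lambda>j. norm (?t (Suc j) * (deriv ^^ Suc j) f z))"
        using st by (simp add: summable_Suc_iff[where f = "\<lambda>j. norm (?t j * (deriv ^^ j) f z)"] del: funpow.simps)
      show "summable (\<lambda>j. maj (Suc j) * fact (Suc j) * (1 / c) ^ Suc j * (B * (1 / 2) ^ N))"
        using sm by (intro summable_mult2) (simp add: summable_Suc_iff[where f = "\<lambda>j. maj j * fact j * (1 / c) ^ j"] del: maj.simps fact_Suc power_Suc)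
    qed
    also have "\<dots> = (\<Sum>j. maj (Suc j) * fact (Suc j) * (1 / c) ^ Suc j) * (B * (1 / 2) ^ N)"
      using sm by (intro suminf_mult2[symmetric]) (simp add: summable_Suc_iff[where f = "\<lambda>j. maj j * fact j * (1 / c) ^ j"] del: maj.simps fact_Suc power_Suc)
    also have "(\<Sum>j. maj (Suc j) * fact (Suc j) * (1 / c) ^ Suc j) \<le> S"
      using suminf_split_head[OF sm] by (simp add: S_def del: maj.simps fact_Suc power_Suc) (simp add: maj.simps)
    finally show ?thesis using B0 by (simp add: mult_right_mono mult_ac)
  qed
  have "(\<lambda>N. tail_op N f z - f z) \<longlonglongrightarrow> 0"
  proof (rule Lim_null_comparison[OF always_eventually])
    show "\<forall>N. norm (tail_op N f z - f z) \<le> S * B * (1 / 2) ^ N" using bound by blast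
    have "(\<lambda>N. S * B * (1 / 2) ^ N) \<longlonglongrightarrow> S * B * 0"
      by (intro tendsto_intros LIMSEQ_power_zero) auto
    then show "(\<lambda>N. S * B * (1 / 2) ^ N) \<longlonglongrightarrow> 0" by simp
  qed
  then show ?thesis by (simp add: LIM_zero_iff)
qed

text \<open>Removing a factor means solving h - h' / \<open>lam N\<close> = known exponential sum.
  Its frequencies differ from \<open>lam N\<close>, so there is no resonance: a particular solution
  is again an exponential sum, and the homogeneous equation adds only a multiple of
  \<open>exp (lam N * z)\<close>.\<close>

lemma tail_op_of_ker:
  assumes f: "f \<in> conv_ker (G1 lam)"
  shows "\<exists>c. \<forall>z. tail_op N f z = (\<Sum>n<N. c n * exp (lam n * z))"
proof (induction N)
  case 0
  then show ?case using f by (simp add: conv_ker_iff)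
next
  case (Suc N)
  have e: "entire f" using f by (simp add: conv_ker_iff)
  from Suc obtain c where c: "\<And>z. tail_op N f z = (\<Sum>n<N. c n * exp (lam n * z))" by blast
  define h where "h = tail_op (Suc N) f"
  define d where "d = (\<lambda>n. c n / (1 - lam n / lam N))"
  define p where "p = (\<lambda>z. \<Sum>n<N. d n * exp (lam n * z))"
  define p' where "p' = (\<lambda>z. \<Sum>n<N. d n * (lam n * exp (lam n * z)))"
  have dc: "d n - d n * lam n / lam N = c n" if "n < N" for n
  proof -
    have "lam n \<noteq> lam N" using that inj by (auto simp: inj_on_def)
    then have "1 - lam n / lam N \<noteq> 0" using nz by (simp add: divide_eq_eq)
    moreover have "d n - d n * lam n / lam N = d n * (1 - lam n / lam N)" by (simp add: algebra_simps)
    ultimately show ?thesis by (simp add: d_def)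
  qed
  have p: "(p has_field_derivative p' z) (at z)" for z
    unfolding p_def p'_def by (auto intro!: derivative_eq_intros sum.cong)
  have pp: "p z - p' z / lam N = tail_op N f z" for z
    unfolding c p_def p'_def sum_divide_distrib sum_subtractf[symmetric]
    by (intro sum.cong refl) (simp add: dc[symmetric] algebra_simps)
  have h: "(h has_field_derivative deriv h z) (at z)" for z
    using entire_tail_op[OF e, of "Suc N"] unfolding h_def entire_def
    by (simp add: holomorphic_derivI)
  have hh: "h z - deriv h z / lam N = tail_op N f z" for z
    unfolding h_def by (rule tail_op_Suc[OF e, symmetric])
  \<comment> \<open>The difference of two solutions satisfies y' = \<open>lam N\<close> y, so the
    integrating factor makes it constant.\<close>
  have "((\<lambda>z. (h z - p z) * exp (- lam N * z)) has_field_derivative 0) (at z)" for z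
  proof -
    have *: "deriv h z = lam N * (h z - tail_op N f z)" "p' z = lam N * (p z - tail_op N f z)"
      using hh[of z] pp[of z] nz[of N] by (auto simp: field_simps)
    have eq: "deriv h z - p' z = lam N * (h z - p z)" unfolding * by (simp add: algebra_simps)
    have "((\<lambda>z. (h z - p z) * exp (- lam N * z)) has_field_derivative
      (deriv h z - p' z) * exp (- lam N * z) + (exp (- lam N * z) * (- lam N)) * (h z - p z)) (at z)"
      by (auto intro!: derivative_eq_intros h p)
    then show ?thesis unfolding eq by (simp add: mult_ac)
  qed
  then obtain K where K: "\<And>z. (h z - p z) * exp (- lam N * z) = K"
    using has_field_derivative_zero_constant[of UNIV "\<lambda>z. (h z - p z) * exp (- lam N * z)"] by auto
  have "h z = p z + K * exp (lam N * z)" for z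
  proof -
    have "K * exp (lam N * z) = (h z - p z) * (exp (- lam N * z) * exp (lam N * z))"
      using K[of z] by simp
    also have "exp (- lam N * z) * exp (lam N * z) = 1" by (simp flip: exp_add)
    finally show ?thesis by simp
  qed
  then have "tail_op (Suc N) f z = (\<Sum>n<Suc N. (d(N := K)) n * exp (lam n * z))" for z
    by (simp add: h_def p_def)
  then show ?case by blast
qed

text \<open>Spectral synthesis: the tails of the product tend to \<open>1\<close>, hence every element of the kernel
  is a limit of exponential sums with frequencies \<open>\<lambda>\<^sub>n\<close>.\<close>

lemma conv_ker_annihilated:
  assumes I: "finite I" and zero: "\<And>n. exp_poly I c (lam n) = 0" and f: "f \<in> conv_ker (G1 lam)"
  shows "(\<Sum>(\<mu>, j)\<in>I. c (\<mu>, j) * (deriv ^^ j) f \<mu>) = 0"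
proof (rule LIMSEQ_unique)
  have e: "entire f" using f by (simp add: conv_ker_iff)
  \<comment> \<open>Tails commute with differentiation, so convergence of the tails carries over to
    every derivative.\<close>
  have "(deriv ^^ j) (tail_op N f) = tail_op N ((deriv ^^ j) f)" for N j
    unfolding tail_op_def by (rule higher_deriv_conv_op[OF summable_tail e])
  then have "(\<lambda>N. (deriv ^^ j) (tail_op N f) \<mu>) \<longlonglongrightarrow> (deriv ^^ j) f \<mu>" for j \<mu>
    using tail_op_tendsto[OF entire_higher_deriv[OF e]] by simp
  then show "(\<lambda>N. \<Sum>(\<mu>, j)\<in>I. c (\<mu>, j) * (deriv ^^ j) (tail_op N f) \<mu>)
     \<longlonglongrightarrow> (\<Sum>(\<mu>, j)\<in>I. c (\<mu>, j) * (deriv ^^ j) f \<mu>)"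
    unfolding case_prod_beta by (intro tendsto_intros)
  have "(\<Sum>(\<mu>, j)\<in>I. c (\<mu>, j) * (deriv ^^ j) (tail_op N f) \<mu>) = 0" for N
  proof -
    obtain d where "\<And>z. tail_op N f z = (\<Sum>n<N. d n * exp (lam n * z))"
      using tail_op_of_ker[OF f] by blast
    then have d: "tail_op N f = (\<lambda>z. \<Sum>n<N. d n * exp (lam n * z))" by blast
    have "(deriv ^^ j) (tail_op N f) \<mu> = (\<Sum>n<N. d n * (lam n ^ j * exp (lam n * \<mu>)))" for j \<mu>
      unfolding d
      by (simp add: higher_deriv_entire_sum higher_deriv_entire_cmult entire_cmult entire_exp higher_deriv_exp_mult)
    then have "(\<Sum>(\<mu>, j)\<in>I. c (\<mu>, j) * (deriv ^^ j) (tail_op N f) \<mu>)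
      = (\<Sum>(\<mu>, j)\<in>I. \<Sum>n<N. d n * (c (\<mu>, j) * lam n ^ j * exp (\<mu> * lam n)))"
      by (simp add: sum_distrib_left mult_ac)
    also have "\<dots> = (\<Sum>n<N. d n * exp_poly I c (lam n))"
      unfolding exp_poly_def case_prod_beta by (subst sum.swap) (simp add: sum_distrib_left)
    finally show ?thesis by (simp add: zero)
  qed
  then show "(\<lambda>N. \<Sum>(\<mu>, j)\<in>I. c (\<mu>, j) * (deriv ^^ j) (tail_op N f) \<mu>) \<longlonglongrightarrow> 0" by simp
qed

lemma exp_in_conv_ker: "(\<lambda>z. exp (lam n * z)) \<in> conv_ker (G1 lam)"
  using tail_op_exp[of 0 "lam n"] by (simp add: conv_ker_iff entire_exp G1_zero)

lemma conv_ker_diff: "f \<in> conv_ker (G1 lam) \<Longrightarrow> g \<in> conv_ker (G1 lam) \<Longrightarrow> (\<lambda>z. f z - g z) \<in> conv_ker (G1 lam)"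
  and conv_ker_cmult: "f \<in> conv_ker (G1 lam) \<Longrightarrow> (\<lambda>z. c * f z) \<in> conv_ker (G1 lam)"
  using conv_op_diff[OF summable_tail[of 0], of f g]
    conv_op_cmult[OF summable_tail[of 0], of f]
  by (auto simp: conv_ker_iff tail_op_def entire_diff entire_cmult)

lemma conv_ker_sum: "(\<And>i. i \<in> I \<Longrightarrow> f i \<in> conv_ker (G1 lam)) \<Longrightarrow> (\<lambda>z. \<Sum>i\<in>I. f i z) \<in> conv_ker (G1 lam)"
  by (auto simp: conv_ker_iff tail_op_def entire_sum conv_op_sum[OF summable_tail[of 0], simplified])

lemma conv_ker_closed:
  assumes f: "\<And>n. f n \<in> conv_ker (G1 lam)" and g: "entire g"
    and lim: "\<And>K. compact K \<Longrightarrow> uniform_limit K f g sequentially"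
  shows "g \<in> conv_ker (G1 lam)"
proof -
  have "tail_op 0 g z = 0" for z
  proof (rule LIMSEQ_unique)
    show "(\<lambda>n. tail_op 0 (f n) z) \<longlonglongrightarrow> tail_op 0 g z"
      unfolding tail_op_def by (rule conv_op_tendsto[OF summable_tail _ g lim])
        (use f in \<open>auto simp: conv_ker_iff\<close>)
    show "(\<lambda>n. tail_op 0 (f n) z) \<longlonglongrightarrow> 0" using f by (simp add: conv_ker_iff)
  qed
  then show ?thesis using g by (simp add: conv_ker_iff)
qed

end

section \<open>Jets, ideals and interpolation\<close>

lemma locally_uniform_limit_entire:
  assumes f: "\<And>n. entire (f n)" and lim: "\<And>K. compact K \<Longrightarrow> uniform_limit K f g sequentially"
  shows "entire g" "(\<lambda>n. (deriv ^^ j) (f n) z) \<longlonglongrightarrow> (deriv ^^ j) g z"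
proof -
  show "entire g" unfolding entire_def
  proof (rule holomorphic_uniform_sequence[of UNIV f])
    fix z :: complex
    show "\<exists>d>0. cball z d \<subseteq> UNIV \<and> uniform_limit (cball z d) f g sequentially"
      using lim[OF compact_cball, of z 1] by (intro exI[of _ 1]) auto
  qed (use f in \<open>auto simp: entire_def\<close>)
  show "(\<lambda>n. (deriv ^^ j) (f n) z) \<longlonglongrightarrow> (deriv ^^ j) g z"
  proof (rule higher_deriv_complex_uniform_limit)
    show "uniform_limit (ball z 1) f g sequentially"
      using lim[OF compact_cball] ball_subset_cball uniform_limit_on_subset by blast
  qed (use f in \<open>auto simp: entire_def intro: always_eventually holomorphic_on_subset\<close>)
qed

text \<open>For j = 0 the truncated \<open>j - 1\<close> is harmless, since its coefficient is
  zero.\<close>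

lemma higher_deriv_linear_factor:
  assumes g: "entire g"
  shows "(deriv ^^ j) (\<lambda>z. (z - \<mu>) * g z) w = (w - \<mu>) * (deriv ^^ j) g w + of_nat j * (deriv ^^ (j - 1)) g w"
proof (induction j arbitrary: w)
  case (Suc j)
  have eq: "(deriv ^^ j) (\<lambda>z. (z - \<mu>) * g z) =
      (\<lambda>w. (w - \<mu>) * (deriv ^^ j) g w + of_nat j * (deriv ^^ (j - 1)) g w)"
    using Suc by blast
  have d: "((deriv ^^ k) g has_field_derivative (deriv ^^ Suc k) g w) (at w)" for k
    using has_field_derivative_higher_deriv[of g UNIV w k] g by (simp add: entire_def)
  have "((\<lambda>w. (w - \<mu>) * (deriv ^^ j) g w + of_nat j * (deriv ^^ (j - 1)) g w) has_field_derivative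
     (deriv ^^ j) g w + (w - \<mu>) * (deriv ^^ Suc j) g w + of_nat j * (deriv ^^ Suc (j - 1)) g w) (at w)"
    by (auto intro!: derivative_eq_intros d simp del: funpow.simps)
  moreover have "of_nat j * (deriv ^^ Suc (j - 1)) g w = of_nat j * (deriv ^^ j) g w"
    by (cases j) (simp_all del: funpow.simps)
  ultimately have "deriv (\<lambda>w. (w - \<mu>) * (deriv ^^ j) g w + of_nat j * (deriv ^^ (j - 1)) g w) w =
    (w - \<mu>) * (deriv ^^ Suc j) g w + of_nat (Suc j) * (deriv ^^ j) g w"
    by (simp add: DERIV_imp_deriv algebra_simps del: funpow.simps)
  then show ?case using eq by simp
qed simp

text \<open>One linear factor is split off at a time. The quotient is entire by removability, and
  its vanishing jet is shorter by one, because the derivative of order j + 1 of f at \<mu> is j + 1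
  times the j-th derivative of the quotient.\<close>

lemma entire_factor_of_vanishing_jet:
  assumes "entire f" "\<And>j. j < k \<Longrightarrow> (deriv ^^ j) f \<mu> = 0"
  shows "\<exists>g. entire g \<and> f = (\<lambda>z. (z - \<mu>) ^ k * g z)"
  using assms
proof (induction k arbitrary: f)
  case (Suc k)
  have f0: "f \<mu> = 0" using Suc.prems(2)[of 0] by simp
  define g where "g = (\<lambda>z. if z = \<mu> then deriv f \<mu> else (f z - f \<mu>) / (z - \<mu>))"
  have g: "entire g" using pole_lemma[of f UNIV \<mu>] Suc.prems(1) by (simp add: entire_def g_def)
  have fg: "f = (\<lambda>z. (z - \<mu>) * g z)" by (auto simp: g_def f0)
  have "(deriv ^^ j) g \<mu> = 0" if "j < k" for j
  proof -
    have "0 = (deriv ^^ Suc j) f \<mu>" using Suc.prems(2)[of "Suc j"] that by simp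
    also have "\<dots> = of_nat (Suc j) * (deriv ^^ j) g \<mu>"
      unfolding fg using higher_deriv_linear_factor[OF g, of "Suc j" \<mu> \<mu>] by simp
    finally show ?thesis by (simp del: of_nat_Suc)
  qed
  from Suc.IH[OF g this] obtain h where "entire h" "g = (\<lambda>z. (z - \<mu>) ^ k * h z)" by blast
  then show ?case using fg by (intro exI[of _ h]) (simp add: mult.assoc)
qed auto

lemma jet_of_factor:
  assumes "entire g"
  shows "(\<forall>j<k. (deriv ^^ j) (\<lambda>z. (z - \<mu>) ^ k * g z) \<mu> = 0) \<and>
    (deriv ^^ k) (\<lambda>z. (z - \<mu>) ^ k * g z) \<mu> = fact k * g \<mu>"
proof (induction k)
  case (Suc k)
  define h where "h = (\<lambda>z. (z - \<mu>) ^ k * g z)"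
  have h: "entire h" unfolding h_def using assms unfolding entire_def by (intro holomorphic_intros)
  have eq: "(\<lambda>z. (z - \<mu>) ^ Suc k * g z) = (\<lambda>z. (z - \<mu>) * h z)" by (simp add: h_def mult.assoc)
  have d: "(deriv ^^ j) (\<lambda>z. (z - \<mu>) * h z) \<mu> = of_nat j * (deriv ^^ (j - 1)) h \<mu>" for j
    using higher_deriv_linear_factor[OF h, of j \<mu> \<mu>] by simp
  have "(deriv ^^ j) (\<lambda>z. (z - \<mu>) * h z) \<mu> = 0" if "j < Suc k" for j
    using that Suc by (cases j) (auto simp: d h_def[symmetric] simp del: funpow.simps)
  moreover have "(deriv ^^ Suc k) (\<lambda>z. (z - \<mu>) * h z) \<mu> = fact (Suc k) * g \<mu>"
    unfolding d using Suc by (simp add: h_def[symmetric] mult.assoc)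
  ultimately show ?case unfolding eq by blast
qed simp

text \<open>Near a node \<psi> is (z - \<mu>) ^ m times a function that is nonzero at \<mu>, so f /
  \<psi> is removable there exactly when the jet of f of length m vanishes.
  \<open>M \<noteq> UNIV\<close> excludes \<psi> = 0, which has no first nonvanishing derivative to
  compare with \<open>zorder\<close>.\<close>

lemma ideal_gen_iff:
  assumes psi: "entire \<psi>" "{z. \<psi> z = 0} = M" "\<forall>\<mu>\<in>M. zorder \<psi> \<mu> = int (m \<mu>)" "M \<noteq> UNIV"
  shows "f \<in> ideal_gen \<psi> \<longleftrightarrow> entire f \<and> (\<forall>\<mu>\<in>M. \<forall>j<m \<mu>. (deriv ^^ j) f \<mu> = 0)"
proof -
  have "\<exists>h. entire h \<and> \<psi> = (\<lambda>z. (z - \<mu>) ^ m \<mu> * h z) \<and> h \<mu> \<noteq> 0" if \<mu>: "\<mu> \<in> M" for \<mu>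
  proof -
    have "\<exists>n. (deriv ^^ n) \<psi> \<mu> \<noteq> 0"
    proof (rule ccontr)
      assume *: "\<not> (\<exists>n. (deriv ^^ n) \<psi> \<mu> \<noteq> 0)"
      have "\<psi> z = 0" for z
      proof -
        have "(\<lambda>n. (deriv ^^ n) \<psi> \<mu> / fact n * (z - \<mu>) ^ n) sums \<psi> z"
          using psi(1) by (intro holomorphic_power_series[of _ _ "dist \<mu> z + 1"])
            (auto simp: entire_def add_nonneg_pos intro: holomorphic_on_subset)
        then show ?thesis using * by (simp add: sums_iff)
      qed
      with psi(2,4) show False by auto
    qed
    define n where "n = (LEAST n. (deriv ^^ n) \<psi> \<mu> \<noteq> 0)"
    have n: "(deriv ^^ n) \<psi> \<mu> \<noteq> 0" unfolding n_def
      using \<open>\<exists>n. _\<close> by (rule LeastI_ex)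
    have n': "(deriv ^^ i) \<psi> \<mu> = 0" if "i < n" for i
      using not_less_Least[of i "\<lambda>n. (deriv ^^ n) \<psi> \<mu> \<noteq> 0"] that unfolding n_def by blast
    have "zorder \<psi> \<mu> = int n"
      by (rule zorder_zero_eqI[of \<psi> UNIV]) (use n n' psi(1) in \<open>auto simp: entire_def\<close>)
    then have nm: "n = m \<mu>" using psi(3) \<mu> by simp
    obtain h where h: "entire h" "\<psi> = (\<lambda>z. (z - \<mu>) ^ m \<mu> * h z)"
      using entire_factor_of_vanishing_jet[OF psi(1), of n \<mu>] n' nm by blast
    have "fact n * h \<mu> \<noteq> 0" using n jet_of_factor[OF h(1), of n \<mu>] h(2) nm by metis
    then show ?thesis using h by auto
  qed
  then obtain h where h: "\<And>\<mu>. \<mu> \<in> M \<Longrightarrow> entire (h \<mu>)"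
      "\<And>\<mu> z. \<mu> \<in> M \<Longrightarrow> \<psi> z = (z - \<mu>) ^ m \<mu> * h \<mu> z" "\<And>\<mu>. \<mu> \<in> M \<Longrightarrow> h \<mu> \<mu> \<noteq> 0"
    by metis
  show ?thesis
  proof
    assume "f \<in> ideal_gen \<psi>"
    then obtain r where r: "entire r" "f = (\<lambda>z. r z * \<psi> z)" by (auto simp: ideal_gen_def)
    have "(deriv ^^ j) f \<mu> = 0" if "\<mu> \<in> M" "j < m \<mu>" for \<mu> j
    proof -
      have "f = (\<lambda>z. (z - \<mu>) ^ m \<mu> * (r z * h \<mu> z))" using r(2) h(2)[OF that(1)] by (simp add: mult_ac)
      then show ?thesis using jet_of_factor[OF entire_mult[OF r(1) h(1)[OF that(1)]], of "m \<mu>" \<mu>] that by simp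
    qed
    then show "entire f \<and> (\<forall>\<mu>\<in>M. \<forall>j<m \<mu>. (deriv ^^ j) f \<mu> = 0)"
      using r entire_mult psi(1) by blast
  next
    assume f: "entire f \<and> (\<forall>\<mu>\<in>M. \<forall>j<m \<mu>. (deriv ^^ j) f \<mu> = 0)"
    then have "\<forall>\<mu>. \<exists>g. \<mu> \<in> M \<longrightarrow> entire g \<and> f = (\<lambda>z. (z - \<mu>) ^ m \<mu> * g z)"
      using entire_factor_of_vanishing_jet by metis
    then obtain g where g: "\<And>\<mu>. \<mu> \<in> M \<Longrightarrow> entire (g \<mu>)"
      "\<And>\<mu> z. \<mu> \<in> M \<Longrightarrow> f z = (z - \<mu>) ^ m \<mu> * g \<mu> z" by metis
    \<comment> \<open>At a node the quotient takes the value of g / h, with which it agrees in a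
      whole neighbourhood, because h stays nonzero nearby.\<close>
    define r where "r = (\<lambda>z. if z \<in> M then g z z / h z z else f z / \<psi> z)"
    have M: "closed M" 
    proof -
      have "continuous_on UNIV \<psi>" using psi(1) by (auto simp: entire_def holomorphic_on_imp_continuous_on)
      then have "closed (\<psi> -` {0})" by (intro closed_vimage) auto
      then show ?thesis using psi(2) by (simp add: vimage_def)
    qed
    have "r field_differentiable (at z)" for z
    proof (cases "z \<in> M")
      case False
      have "(\<lambda>z. f z / \<psi> z) holomorphic_on (- M)"
        using f psi unfolding entire_def by (intro holomorphic_intros) (auto intro: holomorphic_on_subset)
      then have "(\<lambda>z. f z / \<psi> z) field_differentiable (at z)"
        using M False by (auto simp: open_Compl intro: holomorphic_on_imp_differentiable_at)
      then show ?thesis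
        unfolding field_differentiable_def
        using M False has_field_derivative_transform_within_open[of "\<lambda>z. f z / \<psi> z" _ z "- M" r]
        by (auto simp: r_def open_Compl)
    next
      case True
      have "continuous (at z) (h z)" using h(1)[OF True] unfolding entire_def
        by (meson UNIV_I holomorphic_on_imp_differentiable_at field_differentiable_imp_continuous_at open_UNIV)
      then obtain e where e: "e > 0" "\<And>w. dist z w < e \<Longrightarrow> h z w \<noteq> 0"
        using continuous_at_avoid[of z "h z" 0] h(3)[OF True] by (auto simp: dist_commute)
      have "(\<lambda>w. g z w / h z w) holomorphic_on ball z e"
        using g(1)[OF True] h(1)[OF True] e unfolding entire_def
        by (intro holomorphic_intros) (auto intro: holomorphic_on_subset)
      then have "(\<lambda>w. g z w / h z w) field_differentiable (at z)"
        using e by (auto intro: holomorphic_on_imp_differentiable_at)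
      moreover have "r w = g z w / h z w" if "w \<in> ball z e" for w
      proof (cases "w = z")
        case False
        have "\<psi> w \<noteq> 0" using h(2)[OF True, of w] e(2)[of w] that False by auto
        then show ?thesis using psi(2) g(2)[OF True, of w] h(2)[OF True, of w] False
          by (auto simp: r_def)
      qed (simp add: r_def True)
      ultimately show ?thesis
        unfolding field_differentiable_def
        using e(1) has_field_derivative_transform_within_open[of "\<lambda>w. g z w / h z w" _ z "ball z e" r]
        by auto
    qed
    then have "entire r" by (simp add: entire_def holomorphic_on_def)
    moreover have "f z = r z * \<psi> z" for z
    proof (cases "z \<in> M")
      case True
      then have "\<psi> z = 0" using psi(2) by auto
      \<comment> \<open>Exponent 0 would give \<psi> = h at the node, where \<psi> vanishes and h
        does not.\<close>
      moreover have "m z \<noteq> 0"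
        using h(2)[OF True, of z] h(3)[OF True] \<open>\<psi> z = 0\<close> by (cases "m z") auto
      ultimately show ?thesis using g(2)[OF True, of z] by (simp add: power_0_left)
    next
      case False
      then show ?thesis using psi(2) by (auto simp: r_def)
    qed
    ultimately show "f \<in> ideal_gen \<psi>" unfolding ideal_gen_def by blast
  qed
qed

text \<open>Polynomials serve as finitely supported sequences: the coefficient of index n belongs to
  the exponential with frequency \<open>lam n\<close>. Pairing with
  \<open>t n = exp (lam n * z)\<close> evaluates the exponential sum at \<open>z\<close>; other
  choices of \<open>t\<close> give its derivatives.\<close>

definition poly_pair :: "(nat \<Rightarrow> complex) \<Rightarrow> complex poly \<Rightarrow> complex" where
  "poly_pair t p = (\<Sum>n\<le>degree p. coeff p n * t n)"

text \<open>With weights \<open>exp (r * norm (lam n))\<close> this dominates the supremum of the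
  coded exponential sum on the disc of radius \<open>r\<close>.\<close>

definition weighted_norm :: "(nat \<Rightarrow> real) \<Rightarrow> complex poly \<Rightarrow> real" where
  "weighted_norm w p = (\<Sum>n\<le>degree p. norm (coeff p n) * w n)"

lemma poly_pair_extend: "degree p \<le> K \<Longrightarrow> poly_pair t p = (\<Sum>n\<le>K. coeff p n * t n)"
  unfolding poly_pair_def by (rule sum.mono_neutral_left) (auto simp: coeff_eq_0)

lemma weighted_norm_extend: "degree p \<le> K \<Longrightarrow> weighted_norm w p = (\<Sum>n\<le>K. norm (coeff p n) * w n)"
  unfolding weighted_norm_def by (rule sum.mono_neutral_left) (auto simp: coeff_eq_0)

lemma poly_pair_add: "poly_pair t (p + q) = poly_pair t p + poly_pair t q"
proof -
  let ?K = "max (degree p) (degree q)"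
  show ?thesis
    using poly_pair_extend[of "p + q" ?K t] poly_pair_extend[of p ?K t] poly_pair_extend[of q ?K t]
    by (simp add: degree_add_le_max distrib_right sum.distrib)
qed

lemma poly_pair_smult: "poly_pair t (smult c p) = c * poly_pair t p"
  using poly_pair_extend[of "smult c p" "degree p" t]
  by (simp add: poly_pair_def sum_distrib_left mult.assoc)

lemma poly_pair_diff: "poly_pair t (p - q) = poly_pair t p - poly_pair t q"
  using poly_pair_add[of t "p - q" q] by simp

lemma poly_pair_monom: "poly_pair t (monom 1 n) = t n"
  using poly_pair_extend[of "monom 1 n" n t] 
  by (simp add: degree_monom_le if_distrib[of "\<lambda>x. x * _"] sum.delta cong: if_cong)

lemma weighted_norm_monom: "weighted_norm w (monom 1 n) = w n"
proof -
  have "weighted_norm w (monom 1 n) = (\<Sum>k\<le>n. norm (coeff (monom (1::complex) n) k) * w k)"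
    by (rule weighted_norm_extend) (rule degree_monom_le)
  also have "\<dots> = (\<Sum>k\<le>n. if k = n then w k else 0)" by (rule sum.cong) auto
  finally show ?thesis by simp
qed

lemma seminormed_space_weighted_norm:
  assumes w: "\<And>n. w n \<ge> 0"
  shows "seminormed_space smult (weighted_norm w)"
proof
  fix p q :: "complex poly" and c :: complex
  let ?K = "max (degree p) (degree q)"
  have "weighted_norm w (p + q) = (\<Sum>n\<le>?K. norm (coeff p n + coeff q n) * w n)"
    using weighted_norm_extend[of "p + q" ?K w] by (simp add: degree_add_le_max)
  also have "\<dots> \<le> (\<Sum>n\<le>?K. (norm (coeff p n) + norm (coeff q n)) * w n)"
    by (intro sum_mono mult_right_mono norm_triangle_ineq w)
  also have "\<dots> = weighted_norm w p + weighted_norm w q"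
    using weighted_norm_extend[of p ?K w] weighted_norm_extend[of q ?K w]
    by (simp add: distrib_right sum.distrib)
  finally show "weighted_norm w (p + q) \<le> weighted_norm w p + weighted_norm w q" .
  show "weighted_norm w (smult c p) = norm c * weighted_norm w p"
    using weighted_norm_extend[of "smult c p" "degree p" w]
    by (simp add: weighted_norm_def sum_distrib_left norm_mult mult.assoc)
qed (simp_all add: smult_add_right smult_add_left)

lemma norm_poly_pair_le:
  assumes "\<And>n. norm (t n) \<le> w n"
  shows "norm (poly_pair t p) \<le> weighted_norm w p"
  unfolding poly_pair_def weighted_norm_def
  by (intro sum_norm_le) (auto simp: norm_mult intro!: mult_left_mono assms)

lemma exp_poly_restrict:
  assumes "finite I" "J \<subseteq> I" "\<And>i. i \<in> I - J \<Longrightarrow> c i = 0"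
  shows "exp_poly I c z = exp_poly J c z"
  unfolding exp_poly_def by (rule sum.mono_neutral_right) (use assms in auto)

section \<open>Interpolation of jets at the nodes by kernel elements\<close>

locale interp = lacunary_seq lam for lam :: "nat \<Rightarrow> complex" +
  fixes M Lam :: "complex set" and m :: "complex \<Rightarrow> nat" and \<kappa> :: "complex \<Rightarrow> real"
  assumes discrete: "\<And>K. compact K \<Longrightarrow> finite (M \<inter> K)"
    and AB: "\<And>\<tau>. \<tau> \<in> limdirs M \<Longrightarrow> \<exists>\<omega> k. condA M Lam \<tau> \<omega> k \<or> condB M Lam \<tau> \<omega> k"
    and kappa: "\<And>\<omega>. \<omega> \<in> PM M Lam \<Longrightarrow> line_cond M \<omega> (\<kappa> \<omega>)"
    and dirs: "PM M Lam \<subseteq> limdirs (range lam)"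
begin

text \<open>The threshold is arbitrary so that the lemma also covers the levels below. An infinite
  set would contain a sequence tending to infinity in some direction \<tau>, by compactness of the
  circle; (A) or (B) for \<tau> then gives an \<omega> along which Re (\<omega>\<mu>) is unbounded
  on it.\<close>

lemma finite_DM: "finite (DM M Lam k)"
proof (rule ccontr)
  let ?D = "DM M Lam k"
  assume inf: "infinite ?D"
  have "\<exists>x\<in>?D. norm x > real n" for n
  proof (rule ccontr)
    assume "\<not> (\<exists>x\<in>?D. norm x > real n)"
    then have "?D \<subseteq> M \<inter> cball 0 (real n)" by (auto simp: DM_def not_less)
    then show False using finite_subset[OF _ discrete[OF compact_cball]] inf by blast
  qed
  then obtain x where x: "\<And>n. x n \<in> ?D" "\<And>n. norm (x n) > real n" by metis
  have x_inf: "filterlim x at_infinity sequentially"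
  proof (rule filterlim_norm_at_top_imp_at_infinity)
    show "filterlim (\<lambda>n. norm (x n)) at_top sequentially"
      by (rule filterlim_at_top_mono[OF filterlim_real_sequentially])
        (use x(2) in \<open>auto intro: always_eventually less_imp_le\<close>)
  qed
  define u where "u = (\<lambda>n. x n / complex_of_real (norm (x n)))"
  have "u n \<in> sphere 0 1" for n
  proof -
    have "x n \<noteq> 0" using x(2)[of n] by auto
    then show ?thesis by (simp add: u_def norm_divide)
  qed
  then obtain \<tau> r where r: "\<tau> \<in> sphere 0 1" "strict_mono r" "(u \<circ> r) \<longlonglongrightarrow> \<tau>"
    using compact_sphere[of "0::complex" 1] unfolding compact_def by blast
  define y where "y = x \<circ> r"
  have y: "\<And>n. y n \<in> ?D" using x by (simp add: y_def)
  have y_inf: "filterlim y at_infinity sequentially"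
    unfolding y_def using filterlim_compose[OF x_inf filterlim_subseq[OF r(2)]] by (simp add: o_def)
  have y_dir: "(\<lambda>n. y n / of_real (norm (y n))) \<longlonglongrightarrow> \<tau>" using r(3) by (simp add: y_def u_def o_def)
  have yM: "y n \<in> M" for n using y[of n] by (simp add: DM_def)
  have \<tau>: "\<tau> \<in> limdirs M"
    unfolding limdirs_def using r(1) yM y_inf y_dir by auto
  from AB[OF this] obtain \<omega> k' where c: "condA M Lam \<tau> \<omega> k' \<or> condB M Lam \<tau> \<omega> k'" by blast
  then have \<omega>: "\<omega> \<in> PM M Lam" using \<tau> by (auto simp: PM_def)
  have "filterlim (\<lambda>n. Re (\<omega> * y n)) at_top sequentially"
    using c
  proof
    assume A: "condA M Lam \<tau> \<omega> k'"
    have "(\<lambda>n. Re (y n / of_real (norm (y n)) * \<omega>)) \<longlonglongrightarrow> Re (\<tau> * \<omega>)"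
      by (intro tendsto_intros y_dir)
    moreover have "Re (\<tau> * \<omega>) > 0" using A by (simp add: condA_def mult.commute)
    moreover have nrm: "filterlim (\<lambda>n. norm (y n)) at_top sequentially"
      by (rule filterlim_at_infinity_imp_norm_at_top[OF y_inf])
    ultimately have lim: "filterlim (\<lambda>n. Re (y n / of_real (norm (y n)) * \<omega>) * norm (y n)) at_top sequentially"
      by (rule filterlim_tendsto_pos_mult_at_top)
    have "Re (\<omega> * y n) = Re (y n / of_real (norm (y n)) * \<omega>) * norm (y n)" for n
      using Re_mult_direction[of "y n" \<omega>] by (cases "y n = 0") (auto simp: mult.commute)
    then show ?thesis using lim by simp
  next
    assume "condB M Lam \<tau> \<omega> k'"
    then show ?thesis using yM y_inf y_dir by (auto simp: condB_def)
  qed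
  then have "eventually (\<lambda>n. Re (\<omega> * y n) > k \<omega>) sequentially"
    by (simp add: filterlim_at_top_dense)
  then obtain n where "Re (\<omega> * y n) > k \<omega>" by (auto simp: eventually_sequentially)
  moreover have "Re (\<omega> * y n) \<le> k \<omega>" using y[of n] \<omega> by (auto simp: DM_def)
  ultimately show False by simp
qed

lemma bounded_exp_poly_frequency:
  assumes I: "finite I" "fst ` I \<subseteq> M" and i: "(\<mu>, j) \<in> I" "c (\<mu>, j) \<noteq> 0" and \<omega>: "\<omega> \<in> PM M Lam"
    and bd: "\<And>n. norm (exp_poly I c (lam n)) \<le> C * exp (r * norm (lam n))"
  shows "Re (\<omega> * \<mu>) \<le> max r (\<kappa> \<omega>)"
proof -
  obtain x where x: "\<And>k. x k \<in> range lam" "filterlim x at_infinity sequentially"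
      "(\<lambda>k. x k / complex_of_real (norm (x k))) \<longlonglongrightarrow> \<omega>"
    using dirs \<omega> by (auto simp: limdirs_def)
  have "norm (exp_poly I c (x k)) \<le> C * exp (r * norm (x k))" for k
    using bd x(1)[of k] by auto
  from exp_poly_bounded_support[OF x(2,3) I kappa[OF \<omega>] this i] show ?thesis .
qed

definition jets :: "complex set \<Rightarrow> (complex \<times> nat) set" where
  "jets D = Sigma D (\<lambda>\<mu>. {..<m \<mu>})"

lemma finite_jets: "finite D \<Longrightarrow> finite (jets D)"
  by (simp add: jets_def)

lemma vanishing_exp_poly_support:
  assumes D: "finite D" "D \<subseteq> M" and i: "i \<in> jets D" "c i \<noteq> 0"
    and zero: "\<And>n. exp_poly (jets D) c (lam n) = 0"
  shows "i \<in> jets (DM M Lam \<kappa>)"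
proof -
  obtain \<mu> j where ij: "i = (\<mu>, j)" by force
  \<comment> \<open>For a vanishing combination the constant is 0 and any rate may be claimed; the
    rate \<open>\<kappa> \<omega>\<close> reduces the bound to the threshold of D_M.\<close>
  have "Re (\<omega> * \<mu>) \<le> max (\<kappa> \<omega>) (\<kappa> \<omega>)" if "\<omega> \<in> PM M Lam" for \<omega>
    by (rule bounded_exp_poly_frequency[of "jets D" \<mu> j c \<omega> 0 "\<kappa> \<omega>"])
      (use D i ij zero that finite_jets in \<open>auto simp: jets_def\<close>)
  then show ?thesis using i D ij by (auto simp: jets_def DM_def)
qed

text \<open>The nodes that can occur in a combination of jets bounded by the weighted norm of radius
  \<open>r\<close>. Each level is finite and the levels exhaust \<open>M\<close>;
  \<open>level 0\<close> may exceed \<open>DM M Lam \<kappa>\<close> if \<kappa> takes negative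
  values.\<close>

definition level :: "nat \<Rightarrow> complex set" where
  "level r = DM M Lam (\<lambda>\<omega>. max (real r) (\<kappa> \<omega>))"

lemma level_subset: "level r \<subseteq> M" "finite (level r)" "DM M Lam \<kappa> \<subseteq> level r" "level r \<subseteq> level (Suc r)"
  by (auto simp: level_def finite_DM) (auto simp: DM_def le_max_iff_disj)

lemma level_mono: "r \<le> s \<Longrightarrow> level r \<subseteq> level s"
  by (rule lift_Suc_mono_le[of level]) (auto dest: subsetD[OF level_subset(4)])

lemma level_covers:
  assumes "\<mu> \<in> M" "norm \<mu> \<le> real r"
  shows "\<mu> \<in> level r"
proof -
  have "Re (\<omega> * \<mu>) \<le> real r" if "\<omega> \<in> PM M Lam" for \<omega>
  proof -
    have "norm \<omega> = 1" using that dirs by (auto simp: limdirs_def)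
    then have "Re (\<omega> * \<mu>) \<le> norm \<mu>" using complex_Re_le_cmod[of "\<omega> * \<mu>"] by (simp add: norm_mult)
    then show ?thesis using assms by linarith
  qed
  then show ?thesis using assms by (auto simp: level_def DM_def le_max_iff_disj)
qed

text \<open>The derivative of order \<open>snd i\<close> at \<open>fst i\<close> of the exponential
  sum coded by the polynomial.\<close>

definition jet_at :: "complex \<times> nat \<Rightarrow> complex poly \<Rightarrow> complex" where
  "jet_at i = poly_pair (\<lambda>n. lam n ^ snd i * exp (fst i * lam n))"

lemma sum_jet_at_monom: "(\<Sum>i\<in>I. a i * jet_at i (monom 1 n)) = exp_poly I a (lam n)"
  by (simp add: jet_at_def poly_pair_monom exp_poly_def case_prod_beta mult.assoc)

text \<open>A combination of jets on the next level that is bounded by the norm of radius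
  \<open>r\<close> is supported on \<open>level r\<close>, where \<open>p\<close> is already exact.
  So it annihilates the residual, and an arbitrarily small correction exists.\<close>

lemma solve_step:
  assumes start: "\<And>i. i \<in> jets (level r) \<Longrightarrow> jet_at i p = b i"
  shows "\<exists>q. (\<forall>i\<in>jets (level (Suc r)). jet_at i q = b i) \<and>
    weighted_norm (\<lambda>n. exp (real r * norm (lam n))) (q - p) < (1 / 2) ^ r"
proof -
  let ?w = "weighted_norm (\<lambda>n. exp (real r * norm (lam n)))"
  let ?F = "jets (level (Suc r))"
  interpret S: seminormed_space smult ?w by (rule seminormed_space_weighted_norm) simp
  have fin: "finite ?F" by (rule finite_jets[OF level_subset(2)])
  have "\<exists>x\<in>UNIV. (\<forall>i\<in>?F. jet_at i x = b i - jet_at i p) \<and> ?w x < (1 / 2) ^ r"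
  proof (rule S.small_simultaneous_solution[OF _ _ fin S.subspace_UNIV])
    fix a C assume bd: "\<And>x. x \<in> UNIV \<Longrightarrow> norm (\<Sum>i\<in>?F. a i * jet_at i x) \<le> C * ?w x"
    have bd': "norm (exp_poly ?F a (lam n)) \<le> C * exp (real r * norm (lam n))" for n
      using bd[of "monom 1 n"] by (simp add: sum_jet_at_monom weighted_norm_monom)
    have "a i * (b i - jet_at i p) = 0" if i: "i \<in> ?F" for i
    proof (cases "a i = 0")
      case False
      obtain \<mu> j where ij: "i = (\<mu>, j)" by force
      have "Re (\<omega> * \<mu>) \<le> max (real r) (\<kappa> \<omega>)" if "\<omega> \<in> PM M Lam" for \<omega>
        by (rule bounded_exp_poly_frequency[OF fin _ _ _ that bd', of \<mu> j])
          (use i ij False level_subset(1)[THEN subsetD] in \<open>auto simp: jets_def\<close>)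
      then have "i \<in> jets (level r)"
        using i ij by (auto simp: jets_def level_def DM_def)
      then show ?thesis using start by simp
    qed simp
    then show "(\<Sum>i\<in>?F. a i * (b i - jet_at i p)) = 0" by (intro sum.neutral) blast
  qed (simp_all add: jet_at_def poly_pair_add poly_pair_smult)
  then obtain x where x: "\<And>i. i \<in> ?F \<Longrightarrow> jet_at i x = b i - jet_at i p" "?w x < (1 / 2) ^ r" by blast
  have "jet_at i (p + x) = b i" if "i \<in> ?F" for i
    using x(1)[OF that] by (simp add: jet_at_def poly_pair_add)
  then show ?thesis using x(2) by (intro exI[of _ "p + x"]) simp
qed

text \<open>With the zero seminorm, bounded combinations are those vanishing at every
  \<open>lam n\<close>. They are supported on D_M even though the jets are prescribed on the
  possibly larger \<open>level 0\<close>, so the assumption on \<open>b\<close> covers them.\<close>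

lemma solve_start:
  assumes ann: "\<And>c. (\<And>n. exp_poly (jets (DM M Lam \<kappa>)) c (lam n) = 0) \<Longrightarrow>
    (\<Sum>i\<in>jets (DM M Lam \<kappa>). c i * b i) = 0"
  shows "\<exists>p. \<forall>i\<in>jets (level 0). jet_at i p = b i"
proof -
  let ?w = "weighted_norm (\<lambda>n. 0)" and ?F = "jets (level 0)" and ?D = "jets (DM M Lam \<kappa>)"
  interpret S: seminormed_space smult ?w by (rule seminormed_space_weighted_norm) simp
  have fin: "finite ?F" by (rule finite_jets[OF level_subset(2)])
  have sub: "?D \<subseteq> ?F" using level_subset(3) by (auto simp: jets_def)
  have "\<exists>x\<in>UNIV. (\<forall>i\<in>?F. jet_at i x = b i) \<and> ?w x < 1"
  proof (rule S.small_simultaneous_solution[OF _ _ fin S.subspace_UNIV])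
    fix a C assume bd: "\<And>x. x \<in> UNIV \<Longrightarrow> norm (\<Sum>i\<in>?F. a i * jet_at i x) \<le> C * ?w x"
    have zero: "exp_poly ?F a (lam n) = 0" for n
      using bd[of "monom 1 n"] by (simp add: sum_jet_at_monom weighted_norm_monom)
    have supp: "a i = 0" if "i \<in> ?F - ?D" for i
      using vanishing_exp_poly_support[OF level_subset(2,1) _ _ zero] that by blast
    have "exp_poly ?D a (lam n) = 0" for n
      using exp_poly_restrict[OF fin sub supp] zero by simp
    from ann[OF this] have "(\<Sum>i\<in>?D. a i * b i) = 0" .
    moreover have "(\<Sum>i\<in>?F. a i * b i) = (\<Sum>i\<in>?D. a i * b i)"
      by (rule sum.mono_neutral_right[OF fin sub]) (simp add: supp)
    ultimately show "(\<Sum>i\<in>?F. a i * b i) = 0" by simp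
  qed (simp_all add: jet_at_def poly_pair_add poly_pair_smult)
  then show ?thesis by blast
qed

text \<open>Mittag-Leffler procedure: the jets at larger and larger finite sets of nodes are corrected by
  exponential sums that are small on larger and larger discs.\<close>

lemma kernel_interpolation:
  assumes ann: "\<And>c. (\<And>n. exp_poly (jets (DM M Lam \<kappa>)) c (lam n) = 0) \<Longrightarrow>
    (\<Sum>i\<in>jets (DM M Lam \<kappa>). c i * b i) = 0"
  shows "\<exists>g\<in>conv_ker (G1 lam). \<forall>\<mu>\<in>M. \<forall>j<m \<mu>. (deriv ^^ j) g \<mu> = b (\<mu>, j)"
proof -
  have "\<exists>P. \<forall>r. (\<forall>i\<in>jets (level r). jet_at i (P r) = b i) \<and>
      weighted_norm (\<lambda>n. exp (real r * norm (lam n))) (P (Suc r) - P r) < (1 / 2) ^ r"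
    by (rule dependent_nat_choice[where P = "\<lambda>r p. \<forall>i\<in>jets (level r). jet_at i p = b i"
          and Q = "\<lambda>r p q. weighted_norm (\<lambda>n. exp (real r * norm (lam n))) (q - p) < (1 / 2) ^ r"])
      (use solve_start[OF ann] solve_step[where b = b] in blast)+
  then obtain P where P: "\<And>r i. i \<in> jets (level r) \<Longrightarrow> jet_at i (P r) = b i"
    and small: "\<And>r. weighted_norm (\<lambda>n. exp (real r * norm (lam n))) (P (Suc r) - P r) < (1 / 2) ^ r"
    by blast
  define f where "f = (\<lambda>r z. poly_pair (\<lambda>n. exp (lam n * z)) (P r))"
  have f_eq: "f r = (\<lambda>z. \<Sum>n\<le>degree (P r). coeff (P r) n * exp (lam n * z))" for r
    by (simp add: f_def poly_pair_def)
  have f_ker: "f r \<in> conv_ker (G1 lam)" for r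
    unfolding f_eq by (intro conv_ker_sum conv_ker_cmult exp_in_conv_ker)
  then have f_entire: "entire (f r)" for r by (simp add: conv_ker_iff)
  have f_jet: "(deriv ^^ j) (f r) \<mu> = jet_at (\<mu>, j) (P r)" for r \<mu> j
    unfolding f_eq jet_at_def poly_pair_def
    by (simp add: higher_deriv_entire_sum higher_deriv_entire_cmult entire_cmult entire_exp
        higher_deriv_exp_mult mult.commute[of \<mu>])
  have diff: "norm (f (Suc r) z - f r z) \<le> (1 / 2) ^ r" if "norm z \<le> real r" for r z
  proof -
    have nb: "norm (exp (lam n * z)) \<le> exp (real r * norm (lam n))" for n
    proof -
      have "Re (lam n * z) \<le> norm (lam n) * norm z"
        using complex_Re_le_cmod[of "lam n * z"] by (simp add: norm_mult)
      also have "\<dots> \<le> real r * norm (lam n)" using that by (simp add: mult.commute mult_right_mono)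
      finally show ?thesis by simp
    qed
    have "norm (poly_pair (\<lambda>n. exp (lam n * z)) (P (Suc r) - P r))
        \<le> weighted_norm (\<lambda>n. exp (real r * norm (lam n))) (P (Suc r) - P r)"
      by (rule norm_poly_pair_le) (rule nb)
    with small[of r] show ?thesis by (simp add: f_def poly_pair_diff)
  qed
  define g where "g = (\<lambda>z. f 0 z + (\<Sum>r. f (Suc r) z - f r z))"
  have lim: "uniform_limit K f g sequentially" if K: "compact K" for K
  proof -
    obtain B where B: "\<And>z. z \<in> K \<Longrightarrow> norm z \<le> B"
      using compact_imp_bounded[OF K] bounded_iff by blast
    obtain R where R: "B \<le> real R" using real_arch_simple by blast
    \<comment> \<open>The estimate applies only once the disc of radius \<open>r\<close> covers
      \<open>K\<close>, hence the eventual form of the majorant test.\<close>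
    have "uniform_limit K (\<lambda>N z. \<Sum>r<N. f (Suc r) z - f r z) (\<lambda>z. \<Sum>r. f (Suc r) z - f r z) sequentially"
    proof (rule Weierstrass_m_test_ev)
      show "\<forall>\<^sub>F r in sequentially. \<forall>z\<in>K. norm (f (Suc r) z - f r z) \<le> (1 / 2) ^ r"
        using eventually_ge_at_top[of R]
      proof eventually_elim
        case (elim r)
        then show ?case using B R by (intro ballI diff) (meson of_nat_mono order_trans)
      qed
    qed auto
    then have "uniform_limit K (\<lambda>N z. f 0 z + (\<Sum>r<N. f (Suc r) z - f r z)) g sequentially"
      unfolding g_def by (intro uniform_limit_intros)
    moreover have "f 0 z + (\<Sum>r<N. f (Suc r) z - f r z) = f N z" for N z
      using sum_lessThan_telescope[of "\<lambda>r. f r z" N] by simp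
    ultimately show ?thesis by simp
  qed
  note limit = locally_uniform_limit_entire[OF f_entire lim]
  have "g \<in> conv_ker (G1 lam)" by (rule conv_ker_closed[OF f_ker limit(1) lim])
  moreover have "(deriv ^^ j) g \<mu> = b (\<mu>, j)" if \<mu>: "\<mu> \<in> M" "j < m \<mu>" for \<mu> j
  proof (rule LIMSEQ_unique[OF limit(2)])
    obtain R where R: "norm \<mu> \<le> real R" using real_arch_simple by blast
    \<comment> \<open>From stage \<open>R\<close> on the node lies in every level, so these
      derivatives are constant.\<close>
    have "eventually (\<lambda>r. (deriv ^^ j) (f r) \<mu> = b (\<mu>, j)) sequentially"
      using eventually_ge_at_top[of R]
    proof eventually_elim
      case (elim r)
      then have "\<mu> \<in> level r" using level_covers[OF \<mu>(1) R] level_mono by blast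
      then show ?case using P[of "(\<mu>, j)" r] \<mu> by (simp add: f_jet jets_def)
    qed
    then show "(\<lambda>r. (deriv ^^ j) (f r) \<mu>) \<longlonglongrightarrow> b (\<mu>, j)" by (rule tendsto_eventually)
  qed
  ultimately show ?thesis by blast
qed

text \<open>A sequence from \<open>range lam\<close> that tends to infinity eventually avoids the
  first terms, since the moduli increase strictly; so no limit direction is lost in the
  tail.\<close>

lemma interp_shift: "interp (\<lambda>n. lam (n + N)) M Lam \<kappa>"
proof -
  have "limdirs (range lam) \<subseteq> limdirs (range (\<lambda>n. lam (n + N)))"
  proof
    fix \<omega> assume "\<omega> \<in> limdirs (range lam)"
    then obtain x where x: "norm \<omega> = 1" "\<And>k. x k \<in> range lam" "filterlim x at_infinity sequentially"
      "(\<lambda>k. x k / complex_of_real (norm (x k))) \<longlonglongrightarrow> \<omega>"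
      by (auto simp: limdirs_def)
    have "eventually (\<lambda>k. norm (x k) > norm (lam N)) sequentially"
      using filterlim_at_infinity_imp_norm_at_top[OF x(3)] by (simp add: filterlim_at_top_dense)
    then obtain K where K: "\<And>k. k \<ge> K \<Longrightarrow> norm (x k) > norm (lam N)"
      by (auto simp: eventually_sequentially)
    have "x (k + K) \<in> range (\<lambda>n. lam (n + N))" for k
    proof -
      obtain i where i: "x (k + K) = lam i" using x(2) by blast
      then have "N < i" using K[of "k + K"] strict_mono_less[OF norm_strict_mono] by simp
      then have "x (k + K) = lam ((i - N) + N)" using i by simp
      then show ?thesis by blast
    qed
    moreover have "filterlim (\<lambda>k. x (k + K)) at_infinity sequentially"
      using filterlim_compose[OF x(3) filterlim_add_const_nat_at_top] .
    moreover have "(\<lambda>k. x (k + K) / complex_of_real (norm (x (k + K)))) \<longlonglongrightarrow> \<omega>"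
      using LIMSEQ_ignore_initial_segment[OF x(4), of K] .
    ultimately show "\<omega> \<in> limdirs (range (\<lambda>n. lam (n + N)))"
      using x(1) unfolding limdirs_def mem_Collect_eq
      by (intro conjI exI[of _ "\<lambda>k. x (k + K)"]) auto
  qed
  then show ?thesis
    using shift[of N] discrete AB kappa dirs unfolding interp_def interp_axioms_def by blast
qed

end

section \<open>Annihilators of the sum\<close>

lemma exp_sum_eq_0_imp_coeff_0:
  fixes l :: "'i \<Rightarrow> complex" and d :: "'i \<Rightarrow> complex"
  assumes "finite I" "inj_on l I" and zero: "\<And>z. (\<Sum>i\<in>I. d i * exp (l i * z)) = 0" and "i \<in> I"
  shows "d i = 0"
proof -
  define c where "c = (\<lambda>(\<mu>, j :: nat). d (the_inv_into I l \<mu>))"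
  have inj: "inj_on (\<lambda>i. (l i, 0 :: nat)) I" using assms(2) by (auto simp: inj_on_def)
  have cl: "c (l i, 0) = d i" if "i \<in> I" for i
    using that assms(2) by (simp add: c_def the_inv_into_f_f)
  have "exp_poly ((\<lambda>i. (l i, 0)) ` I) c z = 0" for z
  proof -
    have "exp_poly ((\<lambda>i. (l i, 0)) ` I) c z = (\<Sum>i\<in>I. c (l i, 0) * exp (l i * z))"
      unfolding exp_poly_def sum.reindex[OF inj] by simp
    also have "\<dots> = (\<Sum>i\<in>I. d i * exp (l i * z))" by (intro sum.cong refl) (simp add: cl)
    finally show ?thesis by (simp only: zero)
  qed
  then have "c (l i, 0) = 0"
    by (rule exp_poly_eq_0_imp_coeff_0[OF finite_imageI[OF assms(1)]]) (use assms(4) in simp)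
  then show ?thesis using cl[OF assms(4)] by simp
qed

lemma sum_spaceI: "f \<in> A \<Longrightarrow> g \<in> B \<Longrightarrow> (\<lambda>z. f z + g z) \<in> sum_space A B"
  by (auto simp: sum_space_def)

lemma quasi_poly_eq_exp_poly:
  assumes "finite D"
  shows "quasi_poly D m c z = exp_poly (Sigma D (\<lambda>\<mu>. {..<m \<mu>})) (\<lambda>(\<mu>, j). c \<mu> j) z"
  unfolding quasi_poly_def exp_poly_def using assms by (subst sum.Sigma) auto

definition jet_functional :: "(complex \<times> nat) set \<Rightarrow> (complex \<times> nat \<Rightarrow> complex) \<Rightarrow> (complex \<Rightarrow> complex) \<Rightarrow> complex" where
  "jet_functional I c f = (\<Sum>(\<mu>, j)\<in>I. c (\<mu>, j) * (deriv ^^ j) f \<mu>)"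

lemma jet_functional_add:
  "entire f \<Longrightarrow> entire g \<Longrightarrow> jet_functional I c (\<lambda>z. f z + g z) = jet_functional I c f + jet_functional I c g"
  by (simp add: jet_functional_def case_prod_beta higher_deriv_entire_add distrib_left sum.distrib)

lemma jet_functional_cmult:
  "entire f \<Longrightarrow> jet_functional I c (\<lambda>z. a * f z) = a * jet_functional I c f"
  by (simp add: jet_functional_def case_prod_beta higher_deriv_entire_cmult sum_distrib_left mult_ac)

lemma jet_functional_diff:
  "entire f \<Longrightarrow> entire g \<Longrightarrow> jet_functional I c (\<lambda>z. f z - g z) = jet_functional I c f - jet_functional I c g"
  by (simp add: jet_functional_def case_prod_beta higher_deriv_entire_diff right_diff_distrib sum_subtractf)

lemma jet_functional_sum:
  "(\<And>k. k \<in> K \<Longrightarrow> entire (f k)) \<Longrightarrow> jet_functional I c (\<lambda>z. \<Sum>k\<in>K. f k z) = (\<Sum>k\<in>K. jet_functional I c (f k))"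
  unfolding jet_functional_def case_prod_beta
  by (subst sum.swap) (simp add: higher_deriv_entire_sum sum_distrib_left)

text \<open>Turns a point at which quasi-polynomials are evaluated into the frequency of an
  exponential on which their functionals act.\<close>

lemma jet_functional_exp: "jet_functional I c (\<lambda>z. exp (\<xi> * z)) = exp_poly I c \<xi>"
  unfolding jet_functional_def exp_poly_def case_prod_beta higher_deriv_exp_mult by (simp add: mult_ac)

context interp begin

text \<open>From blocks of the first \<open>N\<close> exponentials come combinations with zero jets
  on D_M; their other jets are cancelled by elements of the kernel of the tail beyond
  \<open>N\<close>. No nontrivial combination of the first \<open>N\<close> exponentials lies in
  that kernel, so the differences remain independent.\<close>

lemma infinite_dim_intersection:
  assumes ideal: "\<And>f. f \<in> ideal_gen \<psi> \<longleftrightarrow> entire f \<and> (\<forall>\<mu>\<in>M. \<forall>j<m \<mu>. (deriv ^^ j) f \<mu> = 0)"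
  shows "infinite_dim (conv_ker (G1 lam) \<inter> ideal_gen \<psi>)"
  unfolding infinite_dim_def
proof
  fix n
  let ?A = "jets (DM M Lam \<kappa>)"
  \<comment> \<open>One more than the number of jets on D_M, so each block carries a nontrivial
    combination with all of these jets zero.\<close>
  define B where "B = Suc (card ?A)"
  have finA: "finite ?A" by (rule finite_jets[OF finite_DM])
  define blk where "blk = (\<lambda>k. {k * B..<k * B + B})"
  have "\<forall>k. \<exists>a. (\<exists>i\<in>blk k. a i \<noteq> 0) \<and>
      (\<forall>p\<in>?A. (\<Sum>i\<in>blk k. a i * (lam i ^ snd p * exp (lam i * fst p))) = 0)"
    by (intro allI homogeneous_system_nontrivial finA) (simp_all add: blk_def B_def)
  then obtain a where a: "\<And>k. \<exists>i\<in>blk k. a k i \<noteq> 0"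
      "\<And>k p. p \<in> ?A \<Longrightarrow> (\<Sum>i\<in>blk k. a k i * (lam i ^ snd p * exp (lam i * fst p))) = 0"
    unfolding choice_iff by blast
  have a0: "(\<Sum>i\<in>blk k. a k i * (lam i ^ j * exp (lam i * \<mu>))) = 0" if "(\<mu>, j) \<in> ?A" for k \<mu> j
    using a(2)[OF that, of k] by simp
  define F where "F = (\<lambda>k z. \<Sum>i\<in>blk k. a k i * exp (lam i * z))"
  have F_ker: "F k \<in> conv_ker (G1 lam)" for k
    unfolding F_def by (intro conv_ker_sum conv_ker_cmult exp_in_conv_ker)
  then have F: "entire (F k)" for k by (simp add: conv_ker_iff)
  have F_jet: "(deriv ^^ j) (F k) \<mu> = (\<Sum>i\<in>blk k. a k i * (lam i ^ j * exp (lam i * \<mu>)))" for j k \<mu>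
    unfolding F_def
    by (simp add: higher_deriv_entire_sum higher_deriv_entire_cmult entire_cmult entire_exp higher_deriv_exp_mult)
  define N where "N = n * B"
  interpret s: interp "\<lambda>n. lam (n + N)" M Lam m \<kappa> by (rule interp_shift)
  have "\<exists>h\<in>conv_ker (G1 (\<lambda>n. lam (n + N))). \<forall>\<mu>\<in>M. \<forall>j<m \<mu>. (deriv ^^ j) h \<mu> = (deriv ^^ j) (F k) \<mu>" for k
  proof -
    \<comment> \<open>The prescribed jets vanish on D_M, so the solvability condition holds for
      every \<open>c\<close>.\<close>
    have "(\<Sum>i\<in>?A. c i * (case i of (\<mu>, j) \<Rightarrow> (deriv ^^ j) (F k) \<mu>)) = 0" for c
      by (intro sum.neutral ballI) (auto simp: F_jet a0)
    from s.kernel_interpolation[OF this] show ?thesis by (simp only: prod.case)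
  qed
  then obtain h where h: "\<And>k. h k \<in> conv_ker (G1 (\<lambda>n. lam (n + N)))"
      "\<And>k \<mu> j. \<mu> \<in> M \<Longrightarrow> j < m \<mu> \<Longrightarrow> (deriv ^^ j) (h k) \<mu> = (deriv ^^ j) (F k) \<mu>"
    by metis
  have h_entire: "entire (h k)" for k using h(1) by (simp add: conv_ker_tail_iff)
  define g where "g = (\<lambda>k z. F k z - h k z)"
  have "g k \<in> conv_ker (G1 lam)" for k
    unfolding g_def using F_ker conv_ker_tail_subset h(1) by (blast intro: conv_ker_diff)
  moreover have "g k \<in> ideal_gen \<psi>" for k
    unfolding ideal using h(2) F h_entire by (auto simp: g_def entire_diff higher_deriv_entire_diff)
  moreover have "lin_indep_fun g n"
    unfolding lin_indep_fun_def
  proof (intro allI impI)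
    fix c k assume zero: "lin_comb g n c = (\<lambda>z. 0)" and k: "k < n"
    \<comment> \<open>The blocks tile the indices below \<open>N\<close>, and \<open>i div B\<close>
      recovers the block of \<open>i\<close>; thus \<open>d\<close> collects all coefficients into
      one exponential sum \<open>U\<close>.\<close>
    define d where "d = (\<lambda>i. c (i div B) * a (i div B) i)"
    define U where "U = (\<lambda>z. \<Sum>i<N. d i * exp (lam i * z))"
    have div: "i div B = k'" if "i \<in> blk k'" for i k'
      using that by (auto simp: blk_def B_def intro!: div_nat_eqI simp: mult.commute)
    have "(\<Sum>k<n. c k * F k z) = U z" for z
    proof -
      have "c k' * F k' z = (\<Sum>i\<in>blk k'. d i * exp (lam i * z))" for k'
        unfolding F_def sum_distrib_left by (intro sum.cong refl) (simp add: d_def div)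
      then have "(\<Sum>k<n. c k * F k z) = (\<Sum>k<n. \<Sum>i = k * B..<k * B + B. d i * exp (lam i * z))"
        by (simp add: blk_def)
      also have "\<dots> = U z" unfolding U_def N_def by (rule sum.nat_group)
      finally show ?thesis .
    qed
    then have "U z = (\<Sum>k<n. c k * h k z)" for z
      using fun_cong[OF zero, of z] by (simp add: lin_comb_def g_def right_diff_distrib sum_subtractf)
    then have U: "U = (\<lambda>z. \<Sum>k<n. c k * h k z)" by blast
    have "U \<in> conv_ker (G1 (\<lambda>n. lam (n + N)))"
      unfolding U by (intro s.conv_ker_sum s.conv_ker_cmult h(1))
    then have "tail_op N U z = 0" for z by (simp add: conv_ker_tail_iff)
    moreover have "tail_op N U z = (\<Sum>i<N. d i * (G1 (\<lambda>n. lam (n + N)) (lam i) * exp (lam i * z)))" for z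
      unfolding U_def tail_op_exp[symmetric] unfolding tail_op_def
      by (simp add: conv_op_sum[OF summable_tail] conv_op_cmult[OF summable_tail] entire_cmult entire_exp)
    ultimately have sum0: "(\<Sum>i<N. (d i * G1 (\<lambda>n. lam (n + N)) (lam i)) * exp (lam i * z)) = 0" for z
      by (simp add: mult.assoc)
    have "d i * G1 (\<lambda>n. lam (n + N)) (lam i) = 0" if "i < N" for i
      by (rule exp_sum_eq_0_imp_coeff_0[of "{..<N}" lam "\<lambda>i. d i * G1 (\<lambda>n. lam (n + N)) (lam i)"])
        (use that inj sum0 in \<open>auto intro: inj_on_subset\<close>)
    \<comment> \<open>These are the factors by which the tail operator multiplies the first
      exponentials; the removed frequencies are not zeros of the tail.\<close>
    moreover have "G1 (\<lambda>n. lam (n + N)) (lam i) \<noteq> 0" if "i < N" for i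
      using that inj by (intro s.G1_nonzero) (auto simp: inj_on_def)
    ultimately have d0: "d i = 0" if "i < N" for i using that by auto
    obtain i where i: "i \<in> blk k" "a k i \<noteq> 0" using a(1) by blast
    have "i < k * B + B" using i by (simp add: blk_def)
    also have "k * B + B = Suc k * B" by simp
    also have "Suc k * B \<le> N" unfolding N_def using k by (intro mult_le_mono1) simp
    finally have "d i = 0" by (rule d0)
    then show "c k = 0" using i by (simp add: d_def div)
  qed
  ultimately show "\<exists>g. (\<forall>i<n. g i \<in> conv_ker (G1 lam) \<inter> ideal_gen \<psi>) \<and> lin_indep_fun g n" by blast
qed

text \<open>A biorthogonal basis of the vanishing quasi-polynomials realises the dimension that
  \<open>dM\<close> denotes. Coefficients of a quasi-polynomial are unique, so linear relations
  between quasi-polynomials carry over to their functionals; hence it suffices to test the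
  functionals \<open>C i\<close>.\<close>

lemma annihilator_basis:
  obtains C \<xi> where
    "\<And>i n. i < dM M Lam \<kappa> m lam \<Longrightarrow> exp_poly (jets (DM M Lam \<kappa>)) (C i) (lam n) = 0"
    "\<And>i j. i < dM M Lam \<kappa> m lam \<Longrightarrow> j < dM M Lam \<kappa> m lam \<Longrightarrow>
      exp_poly (jets (DM M Lam \<kappa>)) (C i) (\<xi> j) = of_bool (i = j)"
    "\<And>c f. (\<And>n. exp_poly (jets (DM M Lam \<kappa>)) c (lam n) = 0) \<Longrightarrow>
      (\<And>i. i < dM M Lam \<kappa> m lam \<Longrightarrow> jet_functional (jets (DM M Lam \<kappa>)) (C i) f = 0) \<Longrightarrow>
      jet_functional (jets (DM M Lam \<kappa>)) c f = 0"
proof -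
  let ?A = "jets (DM M Lam \<kappa>)"
  define V where "V = vanishing_qp M Lam \<kappa> m lam"
  have fin: "finite ?A" by (rule finite_jets[OF finite_DM])
  have V: "f \<in> V \<longleftrightarrow> (\<exists>c. f = exp_poly ?A c \<and> (\<forall>n. exp_poly ?A c (lam n) = 0))" for f
  proof -
    have q: "quasi_poly (DM M Lam \<kappa>) m c = exp_poly ?A (\<lambda>(\<mu>, j). c \<mu> j)" for c
      unfolding jets_def using quasi_poly_eq_exp_poly[OF finite_DM] by blast
    have "(\<exists>c. Q (\<lambda>(\<mu>, j). c \<mu> j)) \<longleftrightarrow> (\<exists>c. Q c)" for Q :: "(complex \<times> nat \<Rightarrow> complex) \<Rightarrow> bool"
      by (metis case_prod_curry)
    then show ?thesis unfolding V_def vanishing_qp_def mem_Collect_eq q .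
  qed
  have lin: "exp_poly ?A (\<lambda>i. c i + c' i) z = exp_poly ?A c z + exp_poly ?A c' z"
    "exp_poly ?A (\<lambda>i. a * c i) z = a * exp_poly ?A c z" for a c c' z
    by (simp_all add: exp_poly_def case_prod_beta distrib_right sum.distrib sum_distrib_left mult.assoc)
  have V0: "(\<lambda>z. 0) \<in> V" unfolding V by (intro exI[of _ "\<lambda>_. 0"]) (auto simp: exp_poly_def)
  have Vadd: "(\<lambda>z. f z + g z) \<in> V" if fg: "f \<in> V" "g \<in> V" for f g
  proof -
    obtain c c' where "f = exp_poly ?A c" "\<forall>n. exp_poly ?A c (lam n) = 0"
      "g = exp_poly ?A c'" "\<forall>n. exp_poly ?A c' (lam n) = 0" using fg unfolding V by blast
    then show ?thesis unfolding V by (intro exI[of _ "\<lambda>i. c i + c' i"]) (auto simp: lin)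
  qed
  have Vcmult: "(\<lambda>z. a * f z) \<in> V" if f: "f \<in> V" for a f
  proof -
    obtain c where "f = exp_poly ?A c" "\<forall>n. exp_poly ?A c (lam n) = 0" using f unfolding V by blast
    then show ?thesis unfolding V by (intro exI[of _ "\<lambda>i. a * c i"]) (auto simp: lin)
  qed
  have Vspan: "\<exists>c. f = (\<lambda>z. \<Sum>i\<in>?A. c i * (z ^ snd i * exp (fst i * z)))" if "f \<in> V" for f
    using that unfolding V by (auto simp: exp_poly_def fun_eq_iff case_prod_beta mult.assoc)
  obtain d g \<xi> where g: "\<And>i. i < d \<Longrightarrow> g i \<in> V"
    and \<xi>: "\<And>i j. i < d \<Longrightarrow> j < d \<Longrightarrow> g i (\<xi> j) = of_bool (i = j)"
    and rep: "\<And>f. f \<in> V \<Longrightarrow> f = lin_comb g d (\<lambda>i. f (\<xi> i))" and dim: "has_dim V d"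
    using biorthogonal_basis_exists[OF V0 Vadd Vcmult fin Vspan] by metis
  have d: "dM M Lam \<kappa> m lam = d"
    unfolding dM_def using dim has_dim_unique unfolding V_def by blast
  have "\<forall>i. \<exists>c. i < d \<longrightarrow> g i = exp_poly ?A c \<and> (\<forall>n. exp_poly ?A c (lam n) = 0)"
    using g unfolding V by blast
  then obtain C where C: "\<And>i. i < d \<Longrightarrow> g i = exp_poly ?A (C i)"
      "\<And>i n. i < d \<Longrightarrow> exp_poly ?A (C i) (lam n) = 0" by metis
  show thesis
  proof (rule that[unfolded d, of C \<xi>])
    fix c f assume c: "\<And>n. exp_poly ?A c (lam n) = 0"
      and f: "\<And>i. i < d \<Longrightarrow> jet_functional ?A (C i) f = 0"
    define \<alpha> where "\<alpha> = (\<lambda>i. exp_poly ?A c (\<xi> i))"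
    have "exp_poly ?A c \<in> V" unfolding V using c by blast
    then have r: "exp_poly ?A c = lin_comb g d \<alpha>" unfolding \<alpha>_def by (rule rep)
    have eq: "exp_poly ?A c z = (\<Sum>i<d. \<alpha> i * exp_poly ?A (C i) z)" for z
      using fun_cong[OF r, of z] by (simp add: lin_comb_def C(1))
    have sum_eq: "exp_poly ?A (\<lambda>k. \<Sum>i<d. \<alpha> i * C i k) z = (\<Sum>i<d. \<alpha> i * exp_poly ?A (C i) z)" for z
      unfolding exp_poly_def case_prod_beta sum_distrib_left sum_distrib_right
      by (subst sum.swap) (simp add: mult.assoc)
    have "c k - (\<Sum>i<d. \<alpha> i * C i k) = 0" if "k \<in> ?A" for k
    proof (rule exp_poly_eq_0_imp_coeff_0[OF fin _ that])
      fix z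
      have "exp_poly ?A (\<lambda>k. c k - (\<Sum>i<d. \<alpha> i * C i k)) z
        = exp_poly ?A c z - exp_poly ?A (\<lambda>k. \<Sum>i<d. \<alpha> i * C i k) z"
        by (simp add: exp_poly_def case_prod_beta left_diff_distrib sum_subtractf)
      then show "exp_poly ?A (\<lambda>k. c k - (\<Sum>i<d. \<alpha> i * C i k)) z = 0" by (simp add: sum_eq eq)
    qed
    then have ck: "c k = (\<Sum>i<d. \<alpha> i * C i k)" if "k \<in> ?A" for k using that by simp
    have "jet_functional ?A c f = (\<Sum>k\<in>?A. (\<Sum>i<d. \<alpha> i * C i k) * (deriv ^^ snd k) f (fst k))"
      unfolding jet_functional_def case_prod_beta by (intro sum.cong refl) (simp add: ck)
    also have "\<dots> = (\<Sum>i<d. \<alpha> i * jet_functional ?A (C i) f)"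
      unfolding jet_functional_def case_prod_beta sum_distrib_left sum_distrib_right
      by (subst sum.swap) (simp add: mult.assoc)
    finally show "jet_functional ?A c f = 0" by (simp add: f)
  qed (use C \<xi> in auto)
qed

text \<open>The ideal has zero jets on D_M, and spectral synthesis annihilates the kernel.
  Conversely, if all functionals vanish on f, the jets of f are attained by a kernel element, and
  the difference lies in the ideal.\<close>

lemma sum_space_eq_annihilator:
  assumes ideal: "\<And>f. f \<in> ideal_gen \<psi> \<longleftrightarrow> entire f \<and> (\<forall>\<mu>\<in>M. \<forall>j<m \<mu>. (deriv ^^ j) f \<mu> = 0)"
    and C: "\<And>i n. i < d \<Longrightarrow> exp_poly (jets (DM M Lam \<kappa>)) (C i) (lam n) = 0"
    "\<And>c f. (\<And>n. exp_poly (jets (DM M Lam \<kappa>)) c (lam n) = 0) \<Longrightarrow>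
      (\<And>i. i < d \<Longrightarrow> jet_functional (jets (DM M Lam \<kappa>)) (C i) f = 0) \<Longrightarrow>
      jet_functional (jets (DM M Lam \<kappa>)) c f = 0"
  shows "sum_space (conv_ker (G1 lam)) (ideal_gen \<psi>) =
    {f. entire f \<and> (\<forall>i<d. jet_functional (jets (DM M Lam \<kappa>)) (C i) f = 0)}"
proof (intro equalityI subsetI)
  let ?A = "jets (DM M Lam \<kappa>)"
  fix f
  {
    assume "f \<in> sum_space (conv_ker (G1 lam)) (ideal_gen \<psi>)"
    then obtain k q where f: "f = (\<lambda>z. k z + q z)" and k: "k \<in> conv_ker (G1 lam)" and q: "q \<in> ideal_gen \<psi>"
      by (auto simp: sum_space_def)
    have e: "entire k" "entire q" using k q ideal by (auto simp: conv_ker_iff)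
    have "jet_functional ?A (C i) q = 0" for i
      unfolding jet_functional_def
      using q[unfolded ideal] by (intro sum.neutral) (auto simp: jets_def DM_def)
    moreover have "jet_functional ?A (C i) k = 0" if "i < d" for i
      unfolding jet_functional_def
      by (rule conv_ker_annihilated[OF finite_jets[OF finite_DM] C(1)[OF that] k])
    ultimately show "f \<in> {f. entire f \<and> (\<forall>i<d. jet_functional ?A (C i) f = 0)}"
      using e by (simp add: f entire_add jet_functional_add)
  next
    assume f: "f \<in> {f. entire f \<and> (\<forall>i<d. jet_functional ?A (C i) f = 0)}"
    have ann: "(\<Sum>i\<in>?A. c i * (case i of (\<mu>, j) \<Rightarrow> (deriv ^^ j) f \<mu>)) = 0"
      if "\<And>n. exp_poly ?A c (lam n) = 0" for c
      using C(2)[OF that, of f] f by (simp add: jet_functional_def case_prod_beta)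
    obtain g where g: "g \<in> conv_ker (G1 lam)" "\<And>\<mu> j. \<mu> \<in> M \<Longrightarrow> j < m \<mu> \<Longrightarrow> (deriv ^^ j) g \<mu> = (deriv ^^ j) f \<mu>"
      using kernel_interpolation[OF ann] by auto
    have e: "entire f" "entire g" using f g by (auto simp: conv_ker_iff)
    have "(\<lambda>z. f z - g z) \<in> ideal_gen \<psi>"
      unfolding ideal using e g(2) by (simp add: entire_diff higher_deriv_entire_diff)
    from sum_spaceI[OF g(1) this] show "f \<in> sum_space (conv_ker (G1 lam)) (ideal_gen \<psi>)" by simp
  }
qed

end

text \<open>The functionals \<open>C i\<close> cut out the sum and are dual to the exponentials with
  frequencies \<open>\<xi> j\<close>. Their continuity gives closedness; their duality gives both
  the complement and the exact codimension.\<close>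

theorem theorem1:
  fixes M :: "complex set" and m :: "complex \<Rightarrow> nat" and Lam :: "complex set"
    and lam :: "nat \<Rightarrow> complex" and \<kappa> :: "complex \<Rightarrow> real" and \<psi> :: "complex \<Rightarrow> complex"
  assumes discrete: "\<forall>K. compact K \<longrightarrow> finite (M \<inter> K)"
    and mult: "\<forall>\<mu>\<in>M. m \<mu> \<ge> 1"
    and unbounded: "\<not> bounded Lam"
    and AB: "\<forall>\<tau>\<in>limdirs M. \<exists>\<omega> k. condA M Lam \<tau> \<omega> k \<or> condB M Lam \<tau> \<omega> k"
    and kappa: "\<forall>\<omega>\<in>PM M Lam. line_cond M \<omega> (\<kappa> \<omega>)"
    and lam_in: "\<forall>n. lam n \<in> Lam"
    and lam_nz: "\<forall>n. lam n \<noteq> 0"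
    and lacunary: "\<forall>n. norm (lam (Suc n)) > 2 * norm (lam n)"
    and dirs: "limdirs (range lam) = PM M Lam"
    and psi_entire: "entire \<psi>"
    and psi_zeros: "{z. \<psi> z = 0} = M"
    and psi_mult: "\<forall>\<mu>\<in>M. zorder \<psi> \<mu> = int (m \<mu>)"
  shows "closed_H (sum_space (conv_ker (G1 lam)) (ideal_gen \<psi>))
       \<and> (dM M Lam \<kappa> m lam > 0 \<longrightarrow>
            codim_H (sum_space (conv_ker (G1 lam)) (ideal_gen \<psi>)) (dM M Lam \<kappa> m lam)
          \<and> (\<exists>\<xi>. Hspace = sum_space (sum_space (conv_ker (G1 lam)) (ideal_gen \<psi>))
                                   (span_fun (exps \<xi>) (dM M Lam \<kappa> m lam))))
       \<and> (dM M Lam \<kappa> m lam = 0 \<longrightarrow> Hspace = sum_space (conv_ker (G1 lam)) (ideal_gen \<psi>))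
       \<and> infinite_dim (conv_ker (G1 lam) \<inter> ideal_gen \<psi>)"
proof -
  interpret interp lam M Lam m \<kappa>
    by unfold_locales (use discrete AB kappa lam_nz lacunary dirs in auto)
  \<comment> \<open>A disc is infinite but meets the discrete set \<open>M\<close> in finitely many
    points, so \<psi> is not identically zero.\<close>
  have "infinite (cball (0::complex) 1)"
    using uncountable_cball[of 1 "0::complex"] countable_finite by auto
  then have "M \<noteq> UNIV" using discrete[rule_format, of "cball 0 1"] by auto
  note ideal = ideal_gen_iff[OF psi_entire psi_zeros psi_mult this]
  let ?A = "jets (DM M Lam \<kappa>)" and ?S = "sum_space (conv_ker (G1 lam)) (ideal_gen \<psi>)"
  define d where "d = dM M Lam \<kappa> m lam"
  obtain C \<xi> where C: "\<And>i n. i < d \<Longrightarrow> exp_poly ?A (C i) (lam n) = 0"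
    and \<xi>: "\<And>i j. i < d \<Longrightarrow> j < d \<Longrightarrow> exp_poly ?A (C i) (\<xi> j) = of_bool (i = j)"
    and span: "\<And>c f. (\<And>n. exp_poly ?A c (lam n) = 0) \<Longrightarrow>
      (\<And>i. i < d \<Longrightarrow> jet_functional ?A (C i) f = 0) \<Longrightarrow> jet_functional ?A c f = 0"
    using annihilator_basis unfolding d_def by blast
  have S: "?S = {f. entire f \<and> (\<forall>i<d. jet_functional ?A (C i) f = 0)}"
    by (rule sum_space_eq_annihilator[OF ideal C span])
  have "closed_H ?S"
    unfolding closed_H_def
  proof (intro allI impI)
    fix f g assume f: "\<forall>n. f n \<in> ?S" and lim: "\<forall>K. compact K \<longrightarrow> uniform_limit K f g sequentially"
    have e: "\<And>n. entire (f n)" using f S by auto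
    note limit = locally_uniform_limit_entire[OF e lim[rule_format]]
    have "jet_functional ?A (C i) g = 0" if "i < d" for i
    proof (rule LIMSEQ_unique)
      show "(\<lambda>n. jet_functional ?A (C i) (f n)) \<longlonglongrightarrow> jet_functional ?A (C i) g"
        unfolding jet_functional_def case_prod_beta by (intro tendsto_intros limit(2))
      show "(\<lambda>n. jet_functional ?A (C i) (f n)) \<longlonglongrightarrow> 0" using f S that by auto
    qed
    then show "g \<in> ?S" using S limit(1) by auto
  qed
  have lc_entire: "entire (lin_comb (exps \<xi>) d c)" for c
    unfolding lin_comb_def exps_def by (intro entire_sum entire_cmult entire_exp)
  have lc: "jet_functional ?A (C i) (lin_comb (exps \<xi>) d c) = c i" if "i < d" for i c
  proof -
    have "jet_functional ?A (C i) (lin_comb (exps \<xi>) d c) = (\<Sum>j<d. c j * exp_poly ?A (C i) (\<xi> j))"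
      unfolding lin_comb_def exps_def
      by (simp add: jet_functional_sum jet_functional_cmult jet_functional_exp entire_cmult entire_exp)
    also have "\<dots> = (\<Sum>j<d. if j = i then c i else 0)"
      by (intro sum.cong refl) (use that in \<open>auto simp: \<xi>\<close>)
    finally show ?thesis using that by simp
  qed
  have H: "Hspace = sum_space ?S (span_fun (exps \<xi>) d)"
  proof (intro equalityI subsetI)
    fix f assume "f \<in> Hspace"
    then have f: "entire f" by (simp add: Hspace_def)
    \<comment> \<open>By duality this combination of exponentials has the same functional values as
      \<open>f\<close>, so the rest lies in the sum.\<close>
    define e where "e = lin_comb (exps \<xi>) d (\<lambda>i. jet_functional ?A (C i) f)"
    have "(\<lambda>z. f z - e z) \<in> ?S"
      unfolding S e_def using f by (simp add: entire_diff lc_entire jet_functional_diff lc)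
    moreover have "e \<in> span_fun (exps \<xi>) d" by (auto simp: e_def span_fun_def)
    ultimately have "(\<lambda>z. (f z - e z) + e z) \<in> sum_space ?S (span_fun (exps \<xi>) d)" by (rule sum_spaceI)
    then show "f \<in> sum_space ?S (span_fun (exps \<xi>) d)" by simp
  next
    fix f assume "f \<in> sum_space ?S (span_fun (exps \<xi>) d)"
    then obtain s e where "f = (\<lambda>z. s z + e z)" "s \<in> ?S" "e \<in> span_fun (exps \<xi>) d"
      unfolding sum_space_def[of ?S] by blast
    then show "f \<in> Hspace" using S lc_entire by (auto simp: Hspace_def span_fun_def intro: entire_add)
  qed
  have "codim_H ?S d"
    unfolding codim_H_def
  proof (intro exI[of _ "exps \<xi>"] conjI H allI impI)
    show "exps \<xi> i \<in> Hspace" for i by (simp add: Hspace_def exps_def entire_exp)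
    show "c i = 0" if "lin_comb (exps \<xi>) d c \<in> ?S" "i < d" for c i
      using that S lc[of i c] by auto
  qed
  moreover have "Hspace = ?S" if "d = 0"
    using S that by (simp add: Hspace_def)
  moreover have "infinite_dim (conv_ker (G1 lam) \<inter> ideal_gen \<psi>)"
    by (rule infinite_dim_intersection[OF ideal])
  ultimately show ?thesis using \<open>closed_H ?S\<close> H unfolding d_def by blast
qed

end
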